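(* Let $\|\cdot\|$ be a norm on $\mathbb{R}^n$, let $F:\mathbb{R}^n\to\mathbb{R}^n$ be Lipschitz continuous with constant $\ell$ with respect to $\|\cdot\|$, let $x^0\in\mathbb{R}^n$ be arbitrary, and consider the Cayley iteration $x^{k+1}=R_{\alpha F}(x^k)=2(\mathrm{Id}+\alpha F)^{-1}(x^k)-x^k$ with $\alpha>0$. (i) If $F$ is strongly monotone with respect to $\|\cdot\|$ with monotonicity parameter $c>0$, then for sufficiently small $\alpha>0$ the iteration converges to the unique zero $x^*$ of $F$, and for every $k\ge0$, $\|x^{k+1}-x^*\|\le\frac{e^{-\alpha c}+e^{\alpha\ell}-1-\alpha\ell}{1+\alpha c}\|x^k-x^*\|$. (ii) If $\|\cdot\|$ is a diagonally weighted $\ell_1$ or $\ell_\infty$ norm and $F$ is strongly monotone with respect to $\|\cdot\|$ with monotonicity parameter $c>0$, then for every $\alpha\in]0,1/\mathrm{diagL}(F)]$ the iteration converges to the unique zero $x^*$ of $F$, and for every $k\ge0$, $\|x^{k+1}-x^*\|\le\frac{1-\alpha c}{1+\alpha c}\|x^k-x^*\|$; this factor over this range is minimized at $\alpha=1/\mathrm{diagL}(F)$. (iii) If $\|\cdot\|$ is a diagonally weighted $\ell_1$ or $\ell_\infty$ norm, $F$ is monotone with respect to $\|\cdot\|$, and $\{x:F(x)=0\}\ne\emptyset$, then the iteration $x^{k+1}=\tfrac12x^k+\tfrac12R_{\alpha F}(x^k)$ coincides with the proximal point iteration $x^{k+1}=(\mathrm{Id}+\alpha F)^{-1}(x^k)$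 and converges to a zero of $F$ for every $\alpha\in]0,\infty[$.
   Context: A weak pairing (WP) on $\mathbb{R}^n$ is a map $[\![\cdot,\cdot]\!]:\mathbb{R}^n\times\mathbb{R}^n\to\mathbb{R}$ that is subadditive and continuous in its first argument, satisfies $[\![\alpha x,y]\!]=[\![x,\alpha y]\!]=\alpha[\![x,y]\!]$ for $\alpha\ge0$ and $[\![-x,-y]\!]=[\![x,y]\!]$, $[\![x,x]\!]>0$ for $x\ne0$, and $|[\![x,y]\!]|\le[\![x,x]\!]^{1/2}[\![y,y]\!]^{1/2}$. It is compatible with a norm if $[\![x,x]\!]=\|x\|^2$. WPs are assumed to also satisfy Deimling's inequality $[\![x,y]\!]\le\|y\|\lim_{h\to0^+}h^{-1}(\|y+hx\|-\|y\|)$ and the curve norm derivative formula ($\|x(t)\|D^+\|x(t)\|=[\![\dot x(t),x(t)]\!]$ a.e. for differentiable curves). $F$ is monotone with monotonicity parameter $c\ge0$ w.r.t. $\|\cdot\|$ if for some compatible WP, $-[\![-(F(x)-F(y)),x-y]\!]\ge c\|x-y\|^2$ for all $x,y$ (monotone: $c=0$; strongly monotone: $c>0$). For continuous monotone $F$ and $\alpha>0$, $(\mathrm{Id}+\alpha F)^{-1}$ is single-valued and defined on all of $\mathbb{R}^n$; $R_{\alpha F}=2(\mathrm{Id}+\alpha F)^{-1}-\mathrm{Id}$. For $\eta\in\mathbb{R}^n_{>0}$, $\|x\|_{1,[\eta]}=\sum_i\eta_i|x_i|$ and $\|x\|_{\infty,[\eta]^{-1}}=\max_i|x_i|/\eta_i$.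 For Lipschitz $F$, $\mathrm{diagL}(F):=\sup_{x\in\mathbb{R}^n\setminus\Omega_F}\max_{i}(DF(x))_{ii}$, where $\Omega_F$ is the measure-zero set where $F$ is not differentiable. *)

theory Defs
  imports "HOL-Analysis.Analysis"
begin

definition is_norm :: "(real^'n \<Rightarrow> real) \<Rightarrow> bool" where
  "is_norm N \<longleftrightarrow> (\<forall>x. N x \<ge> 0) \<and> (\<forall>x. N x = 0 \<longleftrightarrow> x = 0)
     \<and> (\<forall>a x. N (a *\<^sub>R x) = \<bar>a\<bar> * N x) \<and> (\<forall>x y. N (x + y) \<le> N x + N y)"

definition wnorm1 :: "(('n::finite) \<Rightarrow> real) \<Rightarrow> real^'n \<Rightarrow> real" where
  "wnorm1 \<eta> x = (\<Sum>i\<in>UNIV. \<eta> i * \<bar>x $ i\<bar>)"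

definition wnorminf :: "(('n::finite) \<Rightarrow> real) \<Rightarrow> real^'n \<Rightarrow> real" where
  "wnorminf \<eta> x = Max ((\<lambda>i. \<bar>x $ i\<bar> / \<eta> i) ` UNIV)"

definition diag_weighted_l1_or_linf :: "(real^('n::finite) \<Rightarrow> real) \<Rightarrow> bool" where
  "diag_weighted_l1_or_linf N \<longleftrightarrow>
     (\<exists>\<eta>. (\<forall>i. \<eta> i > 0) \<and> (N = wnorm1 \<eta> \<or> N = wnorminf \<eta>))"

definition weak_pairing :: "(real^'n \<Rightarrow> real^'n \<Rightarrow> real) \<Rightarrow> bool" where
  "weak_pairing wp \<longleftrightarrow>
     (\<forall>x1 x2 y. wp (x1 + x2) y \<le> wp x1 y + wp x2 y)
   \<and> (\<forall>y. continuous_on UNIV (\<lambda>x. wp x y))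
   \<and> (\<forall>a x y. a \<ge> 0 \<longrightarrow> wp (a *\<^sub>R x) y = a * wp x y \<and> wp x (a *\<^sub>R y) = a * wp x y)
   \<and> (\<forall>x y. wp (-x) (-y) = wp x y)
   \<and> (\<forall>x. x \<noteq> 0 \<longrightarrow> wp x x > 0)
   \<and> (\<forall>x y. \<bar>wp x y\<bar> \<le> sqrt (wp x x) * sqrt (wp y y))"

text \<open>Weak pairing compatible with the norm N, also satisfying Deimling's inequality
  and the curve norm derivative formula (upper right Dini derivative, a.e.).\<close>
definition compatible_wp :: "(real^'n \<Rightarrow> real) \<Rightarrow> (real^'n \<Rightarrow> real^'n \<Rightarrow> real) \<Rightarrow> bool" where
  "compatible_wp N wp \<longleftrightarrow> weak_pairing wp
   \<and> (\<forall>x. wp x x = (N x)\<^sup>2)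
   \<and> (\<forall>x y. wp x y \<le> N y * Lim (at_right 0) (\<lambda>h. (N (y + h *\<^sub>R x) - N y) / h))
   \<and> (\<forall>(c :: real \<Rightarrow> real^'n) c'. (\<forall>t. (c has_vector_derivative c' t) (at t)) \<longrightarrow>
        (AE t in lborel. ereal (N (c t)) *
            Limsup (at_right 0) (\<lambda>h. ereal ((N (c (t + h)) - N (c t)) / h))
          = ereal (wp (c' t) (c t))))"

definition norm_monotone :: "(real^'n \<Rightarrow> real) \<Rightarrow> real \<Rightarrow> (real^'n \<Rightarrow> real^'n) \<Rightarrow> bool" where
  "norm_monotone N c F \<longleftrightarrow> c \<ge> 0 \<and> (\<exists>wp. compatible_wp N wp \<and>
     (\<forall>x y. - wp (- (F x - F y)) (x - y) \<ge> c * (N (x - y))\<^sup>2))"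

definition lipschitz_wrt :: "(real^'n \<Rightarrow> real) \<Rightarrow> real \<Rightarrow> (real^'n \<Rightarrow> real^'n) \<Rightarrow> bool" where
  "lipschitz_wrt N l F \<longleftrightarrow> l \<ge> 0 \<and> (\<forall>x y. N (F x - F y) \<le> l * N (x - y))"

definition resolvent :: "real \<Rightarrow> (real^'n \<Rightarrow> real^'n) \<Rightarrow> real^'n \<Rightarrow> real^'n" where
  "resolvent \<alpha> F y = (THE x. x + \<alpha> *\<^sub>R F x = y)"

definition cayley :: "real \<Rightarrow> (real^'n \<Rightarrow> real^'n) \<Rightarrow> real^'n \<Rightarrow> real^'n" where
  "cayley \<alpha> F y = 2 *\<^sub>R resolvent \<alpha> F y - y"

definition diagL :: "(real^('n::finite) \<Rightarrow> real^'n) \<Rightarrow> real" where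
  "diagL F = Sup {(frechet_derivative F (at x) (axis i 1)) $ i | x i. F differentiable (at x)}"

end

theory Submission
  imports Defs
begin

text \<open>
  Compatibility with a weak pairing is used only through subadditivity and the Cauchy-Schwarz bound,
  which give \<open>(1 + a c) N (x - y) \<le> N (x - y + a (F x - F y))\<close> for all \<open>a \<ge> 0\<close>. Hence resolvents exist
  (invariance of domain) and contract by \<open>1 / (1 + a c)\<close>, and the Cayley map is the forward step
  \<open>Id - a F\<close> composed with the resolvent, so everything reduces to estimating the forward step.

  In (i), the forward step at x is compared with n implicit Euler steps of size \<open>a / n\<close>, and n tends to infinity.
  In (ii), expansivity for small a yields sign conditions on the components of \<open>F (x + u) - F x\<close>;
  combined with the one-sided bound of \<open>F (x + t e_i)\<close> by \<open>diagL F\<close> along coordinate directions, they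
  bound the forward step without differentiating F. Only that one-sided bound needs derivatives: since
  \<open>diagL\<close> sees just the points of differentiability, it rests on Rademacher's theorem.
  In (iii), the resolvent is an averaged nonexpansive map for every step size, so its iterates converge
  by Ishikawa's argument.

  Rademacher's theorem is obtained from Lebesgue's theorem on the line (by Radon-Nikodym) and
  Fubini: adding one coordinate direction b at a time, an estimate valid on a closed set A is transported
  from x to the point of A nearest to \<open>x + t b\<close>, which is at distance \<open>o(t)\<close> for almost every x in A
  because \<open>infdist _ A\<close> is itself Lipschitz and has a minimum at x.
\<close>

section \<open>Rademacher's theorem\<close>

text \<open>Adding a linear function turns \<open>g\<close> into an increasing bijection
  \<open>G\<close>. The measure giving \<open>{a..b}\<close> the mass \<open>G b - G a\<close> is
  absolutely continuous because \<open>G\<close> is Lipschitz, and Lebesgue differentiation of its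
  density yields the derivative.\<close>

lemma lipschitz_real_derivative_ae:
  fixes g :: "real \<Rightarrow> real"
  assumes L: "L-lipschitz_on UNIV g"
  shows "\<exists>Z. negligible Z \<and> (\<forall>x. x \<notin> Z \<longrightarrow> (\<exists>D. (g has_real_derivative D) (at x)))"
proof -
  have L0: "L \<ge> 0" using L by (rule lipschitz_on_nonneg)
  have gl: "\<bar>g x - g y\<bar> \<le> L * \<bar>x - y\<bar>" for x y
    using lipschitz_onD[OF L, of x y] by (simp add: dist_real_def)
  \<comment> \<open>The slope \<open>L + 1\<close> exceeds the steepest descent of \<open>g\<close>
    by 1, so \<open>G\<close> increases with slope at least 1 and is onto.\<close>
  define G where "G = (\<lambda>x. g x + (L + 1) * x)"
  have up: "y - x \<le> G y - G x" if "x \<le> y" for x y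
    using gl[of x y] that unfolding G_def by (auto simp: algebra_simps abs_if split: if_splits)
  have Glip: "(2*L+1)-lipschitz_on UNIV G"
  proof (rule lipschitz_onI)
    fix x y :: real
    have "G x - G y = (g x - g y) + (L+1) * (x - y)" by (simp add: G_def algebra_simps)
    then have "\<bar>G x - G y\<bar> \<le> \<bar>g x - g y\<bar> + (L+1) * \<bar>x - y\<bar>"
      using L0 by (simp add: abs_mult order_trans[OF abs_triangle_ineq])
    with gl[of x y] show "dist (G x) (G y) \<le> (2*L+1) * dist x y"
      by (simp add: dist_real_def algebra_simps)
  qed (use L0 in simp)
  have Gcont: "continuous_on A G" for A
    using lipschitz_on_continuous_on[OF Glip] continuous_on_subset by blast
  have Gmono: "G x < G y \<longleftrightarrow> x < y" for x y
    using up[of x y] up[of y x] by (cases "x < y") auto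
  have Gmono': "G x \<le> G y \<longleftrightarrow> x \<le> y" for x y
    using Gmono[of y x] by auto
  have Ginj: "inj G" by (intro injI) (metis Gmono' order_antisym order_refl)
  have Gsurj: "\<exists>x. G x = y" for y
  proof -
    have "\<exists>x. - \<bar>y - G 0\<bar> \<le> x \<and> x \<le> \<bar>y - G 0\<bar> \<and> G x = y"
      using up[of "- \<bar>y - G 0\<bar>" 0] up[of 0 "\<bar>y - G 0\<bar>"]
      by (intro IVT' Gcont) auto
    then show ?thesis by auto
  qed
  define H where "H = inv G"
  have GH[simp]: "G (H y) = y" for y
    unfolding H_def using Gsurj by (metis surj_f_inv_f surj_def)
  have HG[simp]: "H (G y) = y" for y
    unfolding H_def using Ginj by simp
  have "mono H"
    by (intro monoI) (metis GH Gmono')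
  then have Hm[measurable]: "H \<in> borel_measurable borel"
    by (rule borel_measurable_mono)
  \<comment> \<open>The push-forward along the inverse \<open>H\<close> is the Stieltjes measure of
    \<open>G\<close>: preimages under \<open>H\<close> are images under \<open>G\<close>.\<close>
  define \<nu> where "\<nu> = distr lborel lborel H"
  have pre: "H -` {a..b} = {G a..G b}" for a b
    by (auto simp: Gmono') (metis GH Gmono')+
  have \<nu>I: "emeasure \<nu> {a..b} = ennreal (G b - G a)" if "a \<le> b" for a b
    unfolding \<nu>_def using that by (subst emeasure_distr) (auto simp: pre Gmono')
  have ac: "absolutely_continuous lborel \<nu>"
    unfolding absolutely_continuous_def
  proof
    fix E :: "real set" assume E: "E \<in> null_sets lborel"
    then have "negligible E" by (simp add: negligible_iff_null_sets null_sets_completionI)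
    then have "negligible (G ` E)"
      by (rule negligible_locally_Lipschitz_image[rotated])
        (use lipschitz_onD[OF Glip] in \<open>auto intro!: exI[of _ UNIV] exI[of _ "2*L+1"] simp: dist_norm\<close>)
    moreover have eq: "G ` E = H -` E" by (auto intro: image_eqI[where x="H _"])
    moreover have Eb: "E \<in> sets borel" using E by auto
    then have "H -` E \<in> sets borel"
      using measurable_sets[OF Hm Eb] by simp
    ultimately have "H -` E \<in> null_sets lborel"
      by (metis negligible_iff_null_sets null_sets_completion_iff sets_lborel)
    then show "E \<in> null_sets \<nu>"
      using Eb unfolding \<nu>_def by (auto simp: null_sets_def emeasure_distr)
  qed
  obtain f where f[measurable]: "f \<in> borel_measurable borel" and fd: "density lborel f = \<nu>"
    using sigma_finite_measure.Radon_Nikodym[OF sigma_finite_lborel ac] by (auto simp: \<nu>_def)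
  \<comment> \<open>The density may be infinite on a null set, where \<open>enn2real\<close> returns
    0; finiteness of \<open>\<nu>\<close> on intervals makes this invisible to integrals.\<close>
  define h where "h = (\<lambda>x. enn2real (f x))"
  have hm[measurable]: "h \<in> borel_measurable borel" unfolding h_def by measurable
  have hint: "(h has_integral (G b - G a)) {a..b}" if "a \<le> b" for a b
  proof -
    have eq: "(\<integral>\<^sup>+x. f x * indicator {a..b} x \<partial>lborel) = ennreal (G b - G a)"
      using \<nu>I[OF that] unfolding fd[symmetric] by (subst (asm) emeasure_density) auto
    then have "AE x in lborel. f x * indicator {a..b} x \<noteq> \<infinity>"
      by (intro nn_integral_PInf_AE) auto
    then have ae: "AE x in lborel. f x * indicator {a..b} x = ennreal (h x * indicator {a..b} x)"
      by eventually_elim (auto simp: h_def indicator_def less_top)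
    have "(\<integral>\<^sup>+x. ennreal (h x * indicator {a..b} x) \<partial>lborel) = ennreal (G b - G a)"
      using nn_integral_cong_AE[OF ae] eq by simp
    then have "((\<lambda>x. h x * indicator {a..b} x) has_integral (G b - G a)) UNIV"
      using that by (intro nn_integral_has_integral) (auto simp: h_def Gmono')
    moreover have "(\<lambda>x. h x * indicator {a..b} x) = (\<lambda>x. if x \<in> {a..b} then h x else 0)"
      by (auto simp: indicator_def)
    ultimately show ?thesis
      using has_integral_restrict_UNIV[of "{a..b}" h] by metis
  qed
  \<comment> \<open>The differentiation result used next averages over cubes with lower corner at
    the point, hence gives right difference quotients only. Left ones come from the reflected
    density.\<close>
  have hint': "((\<lambda>x. h (- x)) has_integral (G (-a) - G (-b))) {a..b}" if "a \<le> b" for a b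
    using hint[of "-b" "-a"] that has_integral_reflect_real[of h _ "-a" "-b"]
    by simp
  have "h integrable_on cbox a b" for a b
    by (cases "a \<le> b") (use hint[of a b] in auto)
  from integrable_ccontinuous_explicit[OF this] obtain Z1 where Z1: "negligible Z1"
    and c1: "\<And>x e. x \<notin> Z1 \<Longrightarrow> 0 < e \<Longrightarrow> \<exists>d>0. \<forall>k. 0 < k \<and> k < d \<longrightarrow>
       norm (integral (cbox x (x + k *\<^sub>R One)) h /\<^sub>R k ^ DIM(real) - h x) < e"
    by blast
  have "(\<lambda>x. h (- x)) integrable_on cbox a b" for a b
    by (cases "a \<le> b") (use hint'[of a b] in auto)
  from integrable_ccontinuous_explicit[OF this] obtain Z2 where Z2: "negligible Z2"
    and c2: "\<And>x e. x \<notin> Z2 \<Longrightarrow> 0 < e \<Longrightarrow> \<exists>d>0. \<forall>k. 0 < k \<and> k < d \<longrightarrow>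
       norm (integral (cbox x (x + k *\<^sub>R One)) (\<lambda>x. h (- x)) /\<^sub>R k ^ DIM(real) - h (- x)) < e"
    by blast
  have "\<exists>D. (g has_real_derivative D) (at x)" if x: "x \<notin> Z1 \<union> uminus ` Z2" for x
  proof -
    have "((\<lambda>k. (G (x + k) - G x) / k) \<longlongrightarrow> h x) (at 0)"
      unfolding LIM_def
    proof (intro allI impI)
      fix e :: real assume e: "e > 0"
      obtain d1 where d1: "d1 > 0" "\<And>k. 0 < k \<Longrightarrow> k < d1 \<Longrightarrow> \<bar>(G (x + k) - G x) / k - h x\<bar> < e"
      proof -
        obtain d where d: "d > 0" "\<And>k. 0 < k \<Longrightarrow> k < d \<Longrightarrow> \<bar>integral {x..x + k} h / k - h x\<bar> < e"
          using c1[of x e] x e by (auto simp: divide_inverse mult.commute)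
        moreover have "integral {x..x + k} h = G (x + k) - G x" if "k > 0" for k
          using hint[of x "x + k"] that by (auto simp: integral_unique)
        ultimately show ?thesis using that by auto
      qed
      have "- x \<notin> Z2" using x by (auto simp: image_iff)
      obtain d2 where d2: "d2 > 0" "\<And>k. 0 < k \<Longrightarrow> k < d2 \<Longrightarrow> \<bar>(G x - G (x - k)) / k - h x\<bar> < e"
      proof -
        obtain d where d: "d > 0"
          "\<And>k. 0 < k \<Longrightarrow> k < d \<Longrightarrow> \<bar>integral {-x..-x + k} (\<lambda>x. h (- x)) / k - h x\<bar> < e"
          using c2[of "-x" e] \<open>-x \<notin> Z2\<close> e by (auto simp: divide_inverse mult.commute)
        moreover have "integral {-x..-x + k} (\<lambda>x. h (- x)) = G x - G (x - k)" if "k > 0" for k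
          using hint'[of "-x" "-x + k"] that by (auto simp: integral_unique)
        ultimately show ?thesis using that by auto
      qed
      show "\<exists>d>0. \<forall>k. k \<noteq> 0 \<and> dist k 0 < d \<longrightarrow> dist ((G (x + k) - G x) / k) (h x) < e"
      proof (intro exI[of _ "min d1 d2"] conjI allI impI)
        fix k :: real assume k: "k \<noteq> 0 \<and> dist k 0 < min d1 d2"
        show "dist ((G (x + k) - G x) / k) (h x) < e"
        proof (cases "k > 0")
          case True with k d1 show ?thesis by (simp add: dist_real_def)
        next
          case False
          then have "\<bar>(G x - G (x - (-k))) / (-k) - h x\<bar> < e" using k by (intro d2) (auto simp: dist_real_def)
          moreover have "(G x - G (x - (-k))) / (-k) = (G (x + k) - G x) / k"
            by (simp add: minus_divide_right[symmetric] minus_divide_left)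
          ultimately show ?thesis by (simp add: dist_real_def)
        qed
      qed (use d1 d2 in simp)
    qed
    then have "(G has_real_derivative h x) (at x)" by (simp add: DERIV_def)
    then have "((\<lambda>x. G x - (L+1) * x) has_real_derivative (h x - (L+1) * 1)) (at x)"
      by (intro DERIV_diff DERIV_cmult DERIV_ident)
    then show ?thesis by (auto simp: G_def)
  qed
  moreover have "negligible (uminus ` Z2)"
    by (rule negligible_locally_Lipschitz_image[OF _ Z2])
      (auto intro!: exI[of _ "UNIV :: real set"] exI[of _ "1 :: real"] simp: abs_minus_commute)
  ultimately show ?thesis using Z1 by (intro exI[of _ "Z1 \<union> uminus ` Z2"]) auto
qed

text \<open>Tonelli: for fixed \<open>s\<close> the integral over \<open>x\<close> is the measure of
  a translate of \<open>B\<close>, which is then integrated over a line of infinite length. As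
  \<open>\<infinity> * m\<close> vanishes only for \<open>m = 0\<close>, this passes between null
  sets and null traces on lines in both directions.\<close>

lemma nn_integral_over_lines:
  fixes B :: "'a::euclidean_space set" and b :: 'a
  assumes B: "B \<in> sets borel"
  shows "(\<integral>\<^sup>+x. emeasure lborel {s::real. x + s *\<^sub>R b \<in> B} \<partial>lborel) = \<infinity> * emeasure lborel B"
    and "(\<lambda>x. emeasure lborel {s::real. x + s *\<^sub>R b \<in> B}) \<in> borel_measurable borel"
    and "{s::real. x + s *\<^sub>R b \<in> B} \<in> sets borel"
proof -
  have [measurable]: "B \<in> sets borel" by fact
  show S: "{s::real. x + s *\<^sub>R b \<in> B} \<in> sets borel" for x
    by measurable
  have e: "emeasure lborel {s::real. x + s *\<^sub>R b \<in> B}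
      = (\<integral>\<^sup>+s. indicator B (x + s *\<^sub>R b) \<partial>(lborel :: real measure))" for x
  proof -
    have "indicator {s::real. x + s *\<^sub>R b \<in> B} = (\<lambda>s. indicator B (x + s *\<^sub>R b) :: ennreal)"
      by (auto simp: indicator_def)
    then show ?thesis
      using nn_integral_indicator[of "{s::real. x + s *\<^sub>R b \<in> B}" lborel] S[of x] by simp
  qed
  have m: "(\<lambda>(s::real, x). indicator B (x + s *\<^sub>R b) :: ennreal)
      \<in> borel_measurable (lborel \<Otimes>\<^sub>M lborel)"
    by measurable
  have m': "(\<lambda>(x, s::real). indicator B (x + s *\<^sub>R b) :: ennreal)
      \<in> borel_measurable (lborel \<Otimes>\<^sub>M lborel)"
    by measurable
  have "(\<lambda>x. \<integral>\<^sup>+s. indicator B (x + s *\<^sub>R b) \<partial>(lborel :: real measure)) \<in> borel_measurable lborel"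
    using lborel.borel_measurable_nn_integral_fst[OF m'] by simp
  then show "(\<lambda>x. emeasure lborel {s::real. x + s *\<^sub>R b \<in> B}) \<in> borel_measurable borel"
    by (simp add: e)
  have t: "(\<integral>\<^sup>+x. indicator B (x + v) \<partial>lborel) = emeasure lborel B" for v :: 'a
  proof -
    have "emeasure lborel B = emeasure (distr lborel borel ((+) v)) B"
      by (simp add: lborel_distr_plus)
    also have "\<dots> = (\<integral>\<^sup>+x. indicator B x \<partial>distr lborel borel ((+) v))"
      by simp
    also have "\<dots> = (\<integral>\<^sup>+x. indicator B (v + x) \<partial>lborel)"
      by (subst nn_integral_distr) auto
    finally show ?thesis by (simp add: add.commute)
  qed
  have "(\<integral>\<^sup>+x. \<integral>\<^sup>+s. indicator B (x + s *\<^sub>R b) \<partial>(lborel :: real measure) \<partial>lborel)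
     = (\<integral>\<^sup>+s. \<integral>\<^sup>+x. indicator B (x + s *\<^sub>R b) \<partial>lborel \<partial>(lborel :: real measure))"
    using lborel_pair.Fubini'[OF m] by simp
  also have "\<dots> = \<infinity> * emeasure lborel B"
    by (simp add: t mult.commute)
  finally show "(\<integral>\<^sup>+x. emeasure lborel {s::real. x + s *\<^sub>R b \<in> B} \<partial>lborel) = \<infinity> * emeasure lborel B"
    by (simp add: e)
qed

lemma negligible_if_negligible_on_lines:
  fixes B :: "'a::euclidean_space set" and b :: 'a
  assumes B: "B \<in> sets borel" and l: "\<And>x. negligible {s::real. x + s *\<^sub>R b \<in> B}"
  shows "negligible B"
proof -
  have "emeasure lborel {s::real. x + s *\<^sub>R b \<in> B} = 0" for x
    using l[of x] nn_integral_over_lines(3)[OF B, of x b]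
    by (metis emeasure_lborel_Icc_eq negligible_iff_emeasure0 sets_lborel null_setsD1 null_sets_completion_iff negligible_iff_null_sets)
  then have "\<infinity> * emeasure lborel B = 0"
    using nn_integral_over_lines(1)[OF B, of b] by simp
  then have "emeasure lborel B = 0" by auto
  then show ?thesis
    using B by (simp add: negligible_iff_null_sets null_sets_completionI null_setsI)
qed

lemma negligible_on_almost_all_lines:
  fixes B :: "'a::euclidean_space set" and b :: 'a
  assumes B: "negligible B"
  shows "\<exists>Z. negligible Z \<and> (\<forall>x. x \<notin> Z \<longrightarrow> negligible {s::real. x + s *\<^sub>R b \<in> B})"
proof -
  \<comment> \<open>The formula over lines is for Borel sets, so the null set is first enclosed in a
    Borel null set.\<close>
  obtain C where C: "B \<subseteq> C" "C \<in> null_sets lborel"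
    using B by (auto simp: negligible_iff_null_sets null_sets_completion_iff2)
  then have Cb: "C \<in> sets borel" by auto
  have "(\<integral>\<^sup>+x. emeasure lborel {s::real. x + s *\<^sub>R b \<in> C} \<partial>lborel) = 0"
    using nn_integral_over_lines(1)[OF Cb, of b] C by auto
  then have ae: "AE x in lborel. emeasure lborel {s::real. x + s *\<^sub>R b \<in> C} = 0"
    using nn_integral_over_lines(2)[OF Cb, of b] by (subst (asm) nn_integral_0_iff_AE) auto
  then obtain Z where Z: "Z \<in> null_sets lborel" "{x. emeasure lborel {s::real. x + s *\<^sub>R b \<in> C} \<noteq> 0} \<subseteq> Z"
    by (auto elim!: AE_E simp: null_sets_def)
  have "negligible {s::real. x + s *\<^sub>R b \<in> B}" if "x \<notin> Z" for x
  proof -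
    have "emeasure lborel {s::real. x + s *\<^sub>R b \<in> C} = 0" using Z that by auto
    then have "{s::real. x + s *\<^sub>R b \<in> C} \<in> null_sets lborel"
      using nn_integral_over_lines(3)[OF Cb, of x b] by auto
    then have "negligible {s::real. x + s *\<^sub>R b \<in> C}"
      by (simp add: negligible_iff_null_sets null_sets_completionI)
    then show ?thesis by (rule negligible_subset) (use C in auto)
  qed
  moreover have "negligible Z" using Z(1) by (simp add: negligible_iff_null_sets null_sets_completionI)
  ultimately show ?thesis by auto
qed

text \<open>The Cauchy form does not mention the derivative and, apart from \<open>t\<close> and
  \<open>u\<close>, quantifies over naturals only. It serves to show that the set of points of
  non-differentiability is Borel.\<close>

lemma differentiable_iff_Cauchy_quotients:
  fixes g :: "real \<Rightarrow> real"
  shows "(\<exists>D. (g has_real_derivative D) (at s)) \<longleftrightarrow>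
    (\<forall>k::nat. \<exists>m::nat. \<forall>t u. t \<noteq> 0 \<and> \<bar>t\<bar> < 1 / (real m + 1) \<and> u \<noteq> 0 \<and> \<bar>u\<bar> < 1 / (real m + 1) \<longrightarrow>
      \<bar>(g (s + t) - g s) / t - (g (s + u) - g s) / u\<bar> \<le> 1 / (real k + 1))"
    (is "?L \<longleftrightarrow> ?R")
proof
  define q where "q = (\<lambda>t. (g (s + t) - g s) / t)"
  {
    assume ?L
    then obtain D where D: "q \<midarrow>0\<rightarrow> D" by (auto simp: DERIV_def q_def)
    show ?R
    proof
      fix k :: nat
      obtain d where d: "d > 0" "\<And>t. t \<noteq> 0 \<Longrightarrow> \<bar>t\<bar> < d \<Longrightarrow> \<bar>q t - D\<bar> < 1 / (real k + 1) / 2"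
        using LIM_D[OF D, of "1 / (real k + 1) / 2"] by auto
      obtain m :: nat where m: "1 / (real m + 1) < d"
        using reals_Archimedean[OF d(1)] by (auto simp: inverse_eq_divide add.commute)
      have half: "\<bar>a - b\<bar> \<le> e" if "\<bar>a - D\<bar> < e / 2" "\<bar>b - D\<bar> < e / 2" for a b e :: real
        using that by linarith
      have "\<bar>q t - q u\<bar> \<le> 1 / (real k + 1)"
        if "t \<noteq> 0" "\<bar>t\<bar> < 1 / (real m + 1)" "u \<noteq> 0" "\<bar>u\<bar> < 1 / (real m + 1)" for t u
        by (rule half[OF d(2)[OF that(1) less_trans[OF that(2) m]] d(2)[OF that(3) less_trans[OF that(4) m]]])
      then show "\<exists>m::nat. \<forall>t u. t \<noteq> 0 \<and> \<bar>t\<bar> < 1 / (real m + 1) \<and> u \<noteq> 0 \<and> \<bar>u\<bar> < 1 / (real m + 1) \<longrightarrow>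
        \<bar>(g (s + t) - g s) / t - (g (s + u) - g s) / u\<bar> \<le> 1 / (real k + 1)"
        unfolding q_def by blast
    qed
  next
    assume R: ?R
    have ex: "\<exists>d>0. \<forall>t u. t \<noteq> 0 \<and> \<bar>t\<bar> < d \<and> u \<noteq> 0 \<and> \<bar>u\<bar> < d \<longrightarrow> \<bar>q t - q u\<bar> \<le> e"
      if e: "e > 0" for e
    proof -
      obtain k :: nat where k: "1 / (real k + 1) < e"
        using reals_Archimedean[OF e] by (auto simp: inverse_eq_divide add.commute)
      obtain m :: nat where m: "\<And>t u. t \<noteq> 0 \<and> \<bar>t\<bar> < 1 / (real m + 1) \<and> u \<noteq> 0 \<and> \<bar>u\<bar> < 1 / (real m + 1) \<Longrightarrow>
        \<bar>q t - q u\<bar> \<le> 1 / (real k + 1)"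
        using R unfolding q_def by blast
      show ?thesis
        by (intro exI[of _ "1 / (real m + 1)"] conjI allI impI order_trans[OF m less_imp_le[OF k]]) auto
    qed
    \<comment> \<open>Quotients along this one null sequence select the candidate \<open>D\<close>;
      the Cauchy condition carries the limit over to all increments.\<close>
    define t where "t = (\<lambda>n. 1 / (real n + 1))"
    have t0: "t n > 0" for n by (simp add: t_def)
    have tlim: "t \<longlonglongrightarrow> 0"
      unfolding t_def using LIMSEQ_inverse_real_of_nat by (simp add: inverse_eq_divide add.commute)
    have "Cauchy (\<lambda>n. q (t n))"
    proof (rule CauchyI)
      fix e :: real assume e: "e > 0"
      obtain d where d: "d > 0" "\<And>t u. t \<noteq> 0 \<and> \<bar>t\<bar> < d \<and> u \<noteq> 0 \<and> \<bar>u\<bar> < d \<Longrightarrow> \<bar>q t - q u\<bar> \<le> e / 2"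
        using ex[of "e/2"] e by auto
      obtain M where M: "\<And>n. n \<ge> M \<Longrightarrow> \<bar>t n\<bar> < d"
        using LIMSEQ_D[OF tlim d(1)] by auto
      have "norm (q (t m) - q (t n)) < e" if "m \<ge> M" "n \<ge> M" for m n
        using d(2)[of "t m" "t n"] M[of m] M[of n] that t0[of m] t0[of n] e by auto
      then show "\<exists>M. \<forall>m\<ge>M. \<forall>n\<ge>M. norm (q (t m) - q (t n)) < e"
        by blast
    qed
    then obtain D where D: "(\<lambda>n. q (t n)) \<longlonglongrightarrow> D"
      using Cauchy_convergent_iff convergentD by blast
    have "q \<midarrow>0\<rightarrow> D"
      unfolding LIM_eq
    proof (intro allI impI)
      fix e :: real assume e: "e > 0"
      obtain d where d: "d > 0" "\<And>t u. t \<noteq> 0 \<and> \<bar>t\<bar> < d \<and> u \<noteq> 0 \<and> \<bar>u\<bar> < d \<Longrightarrow> \<bar>q t - q u\<bar> \<le> e / 2"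
        using ex[of "e/2"] e by auto
      obtain M where M: "\<And>n. n \<ge> M \<Longrightarrow> \<bar>t n\<bar> < d"
        using LIMSEQ_D[OF tlim d(1)] by auto
      have "\<bar>q u - D\<bar> \<le> e / 2" if u: "u \<noteq> 0" "\<bar>u\<bar> < d" for u
      proof (rule LIMSEQ_le_const2)
        show "(\<lambda>n. \<bar>q u - q (t n)\<bar>) \<longlonglongrightarrow> \<bar>q u - D\<bar>" by (intro tendsto_intros D)
        show "\<exists>M. \<forall>n\<ge>M. \<bar>q u - q (t n)\<bar> \<le> e / 2"
          using d(2)[of u] M t0 u by (metis less_irrefl)
      qed
      then show "\<exists>r>0. \<forall>x. x \<noteq> 0 \<and> norm (x - 0) < r \<longrightarrow> norm (q x - D) < e"
        using d(1) e by (intro exI[of _ d]) fastforce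
    qed
    then show ?L by (auto simp: DERIV_def q_def)
  }
qed

text \<open>Each line parallel to \<open>b\<close> meets the bad set \<open>B\<close> in a null set
  by the result on the line. Fubini then makes \<open>B\<close> null, once it is known to be
  Borel.\<close>

lemma lipschitz_directional_derivative_ae:
  fixes f :: "'a::euclidean_space \<Rightarrow> real" and b :: 'a
  assumes L: "L-lipschitz_on UNIV f"
  shows "\<exists>Z. negligible Z \<and>
    (\<forall>x. x \<notin> Z \<longrightarrow> (\<exists>D. ((\<lambda>t. f (x + t *\<^sub>R b)) has_real_derivative D) (at 0)))"
proof -
  have cont: "continuous_on UNIV f" using L by (rule lipschitz_on_continuous_on)
  define B where "B = {x. \<nexists>D. ((\<lambda>t. f (x + t *\<^sub>R b)) has_real_derivative D) (at 0)}"
  define E where "E = (\<lambda>(k::nat) t u. {x. \<bar>(f (x + t *\<^sub>R b) - f x) / t - (f (x + u *\<^sub>R b) - f x) / u\<bar> \<le> 1 / (real k + 1)})"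
  define T where "T = (\<lambda>m::nat. {t. t \<noteq> 0 \<and> \<bar>t\<bar> < 1 / (real m + 1)})"
  have "x \<in> B \<longleftrightarrow> \<not> (\<forall>k. \<exists>m. \<forall>t\<in>T m. \<forall>u\<in>T m. x \<in> E k t u)" for x
    unfolding B_def differentiable_iff_Cauchy_quotients E_def T_def by (simp add: Ball_def imp_conjL)
  \<comment> \<open>The uncountable intersections over \<open>t\<close> and \<open>u\<close> are of
    closed sets, hence closed; those over \<open>k\<close> and unions over \<open>m\<close> are
    countable.\<close>
  then have Beq: "B = UNIV - (\<Inter>k. \<Union>m. \<Inter>t\<in>T m. \<Inter>u\<in>T m. E k t u)"
    by (simp add: set_eq_iff)
  have "closed (E k t u)" if "t \<in> T m" "u \<in> T m" for k m t u
    using that unfolding E_def T_def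
    by (intro closed_Collect_le continuous_intros continuous_on_compose2[OF cont] ) auto
  then have Bb: "B \<in> sets borel"
    unfolding Beq by (intro sets.Diff sets.countable_INT'' sets.countable_UN'' borel_closed closed_INT ballI) auto
  have "negligible {s::real. x + s *\<^sub>R b \<in> B}" for x
  proof -
    have "(L * norm b)-lipschitz_on UNIV (\<lambda>s. f (x + s *\<^sub>R b))"
    proof (rule lipschitz_onI)
      fix s t :: real
      have "dist (f (x + s *\<^sub>R b)) (f (x + t *\<^sub>R b)) \<le> L * dist (x + s *\<^sub>R b) (x + t *\<^sub>R b)"
        by (rule lipschitz_onD[OF L UNIV_I UNIV_I])
      also have "dist (x + s *\<^sub>R b) (x + t *\<^sub>R b) = norm b * dist s t"
        by (simp add: dist_norm scaleR_diff_left[symmetric] mult.commute)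
      finally show "dist (f (x + s *\<^sub>R b)) (f (x + t *\<^sub>R b)) \<le> L * norm b * dist s t" by simp
    qed (use lipschitz_on_nonneg[OF L] in auto)
    from lipschitz_real_derivative_ae[OF this] obtain Z where Z: "negligible Z"
      "\<And>s. s \<notin> Z \<Longrightarrow> \<exists>D. ((\<lambda>s. f (x + s *\<^sub>R b)) has_real_derivative D) (at s)"
      by auto
    have "{s::real. x + s *\<^sub>R b \<in> B} \<subseteq> Z"
    proof
      fix s assume "s \<in> {s::real. x + s *\<^sub>R b \<in> B}"
      then have n: "\<nexists>D. ((\<lambda>t. f (x + (t + s) *\<^sub>R b)) has_real_derivative D) (at 0)"
        by (simp add: B_def algebra_simps)
      show "s \<in> Z"
      proof (rule ccontr)
        assume "s \<notin> Z"
        then obtain D where "((\<lambda>s. f (x + s *\<^sub>R b)) has_real_derivative D) (at (0 + s))" using Z by auto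
        then show False using n unfolding DERIV_shift by auto
      qed
    qed
    then show ?thesis using Z negligible_subset by blast
  qed
  then have "negligible B" by (rule negligible_if_negligible_on_lines[OF Bb])
  then show ?thesis by (intro exI[of _ B]) (auto simp: B_def)
qed

text \<open>In the induction below, \<open>A\<close> collects the points satisfying a uniform
  estimate; this supplies such a point close to \<open>x + t b\<close>, which itself may fall
  outside \<open>A\<close>.\<close>

lemma closed_nonporous_ae:
  fixes A :: "'a::euclidean_space set" and b :: 'a
  assumes A: "closed A"
  shows "\<exists>Z. negligible Z \<and> (\<forall>x\<in>A - Z. \<forall>e>0. \<exists>d>0. \<forall>t. \<bar>t\<bar> < d \<longrightarrow> (\<exists>p\<in>A. dist p (x + t *\<^sub>R b) \<le> e * \<bar>t\<bar>))"
proof (cases "A = {}")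
  case False
  have "1-lipschitz_on UNIV (\<lambda>x. infdist x A)"
    by (intro lipschitz_onI) (auto simp: dist_real_def infdist_triangle_abs)
  from lipschitz_directional_derivative_ae[OF this, of b] obtain Z where Z: "negligible Z"
    "\<And>x. x \<notin> Z \<Longrightarrow> \<exists>D. ((\<lambda>t. infdist (x + t *\<^sub>R b) A) has_real_derivative D) (at 0)" by auto
  have "\<exists>d>0. \<forall>t. \<bar>t\<bar> < d \<longrightarrow> (\<exists>p\<in>A. dist p (x + t *\<^sub>R b) \<le> e * \<bar>t\<bar>)" if x: "x \<in> A - Z" and e: "e > 0" for x e
  proof -
    obtain D where D: "((\<lambda>t. infdist (x + t *\<^sub>R b) A) has_real_derivative D) (at 0)" using Z x by auto
    \<comment> \<open>The distance is nonnegative and equals 0 at \<open>t = 0\<close>, so it has a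
      minimum there.\<close>
    have "D = 0"
      using D by (rule DERIV_local_min[of _ _ _ 1]) (use x in \<open>auto simp: infdist_nonneg\<close>)
    with D have "(\<lambda>h. infdist (x + h *\<^sub>R b) A / h) \<midarrow>0\<rightarrow> 0"
      using x by (simp add: DERIV_def)
    from LIM_D[OF this e] obtain d where d: "d > 0" "\<And>h. h \<noteq> 0 \<Longrightarrow> \<bar>h\<bar> < d \<Longrightarrow> infdist (x + h *\<^sub>R b) A / \<bar>h\<bar> < e"
      by (auto simp: infdist_nonneg)
    have "\<exists>p\<in>A. dist p (x + t *\<^sub>R b) \<le> e * \<bar>t\<bar>" if t: "\<bar>t\<bar> < d" for t
    proof (cases "t = 0")
      case True then show ?thesis using x by (auto intro!: bexI[of _ x])
    next
      case nz: False
      obtain p where p: "p \<in> A" "infdist (x + t *\<^sub>R b) A = dist (x + t *\<^sub>R b) p"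
        using infdist_attains_inf[OF A False] by blast
      then show ?thesis using d(2)[OF nz t] nz
        by (intro bexI[of _ p]) (auto simp: field_simps dist_commute)
    qed
    then show ?thesis using d by auto
  qed
  then show ?thesis using Z by (intro exI[of _ Z]) auto
qed auto

text \<open>Induction over the coordinate directions. An estimate along \<open>span B\<close> with a
  radius independent of \<open>t\<close> need not hold at \<open>x + t b\<close> itself; it is
  borrowed from a nearby point \<open>p\<close> of a set where the estimate is uniform, and the
  Lipschitz bound pays for the jumps to and from \<open>p\<close>.\<close>

lemma lipschitz_differentiable_on_span_ae:
  fixes f :: "'a::euclidean_space \<Rightarrow> real"
  assumes L: "L-lipschitz_on UNIV f" and "B \<subseteq> Basis"
  shows "\<exists>Z. negligible Z \<and> (\<forall>x. x \<notin> Z \<longrightarrow> (\<exists>a. \<forall>e>0. \<exists>d>0. \<forall>w\<in>span B.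
    norm w < d \<longrightarrow> \<bar>f (x + w) - f x - a \<bullet> w\<bar> \<le> e * norm w))"
  using finite_subset[OF assms(2) finite_Basis] assms(2)
proof (induction B rule: finite_induct)
  case empty
  show ?case by (intro exI[of _ "{}"]) (auto intro!: exI[of _ 0] exI[of _ 1])
next
  case (insert b B)
  have L0: "L \<ge> 0" using L by (rule lipschitz_on_nonneg)
  have fl: "\<bar>f x - f y\<bar> \<le> L * norm (x - y)" for x y
    using lipschitz_onD[OF L UNIV_I UNIV_I, of x y] by (simp add: dist_norm)
  have cont: "continuous_on UNIV f" using L by (rule lipschitz_on_continuous_on)
  have b: "b \<in> Basis" "B \<subseteq> Basis" using insert by auto
  have orth: "w \<bullet> b = 0" if "w \<in> span B" for w
  proof -
    have "b \<bullet> y = 0" if "y \<in> B" for y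
      using inner_not_same_Basis[of b y] insert.hyps(2) b that by auto
    then have "b \<bullet> w = 0"
      using orthogonal_to_span[of w B b] that by (auto simp: orthogonal_def)
    then show ?thesis by (simp add: inner_commute)
  qed
  obtain Z0 where Z0: "negligible Z0" "\<And>x. x \<notin> Z0 \<Longrightarrow> \<exists>a. \<forall>e>0. \<exists>d>0. \<forall>w\<in>span B.
    norm w < d \<longrightarrow> \<bar>f (x + w) - f x - a \<bullet> w\<bar> \<le> e * norm w"
    using insert.IH b(2) by blast
  obtain Zb where Zb: "negligible Zb"
    "\<And>x. x \<notin> Zb \<Longrightarrow> \<exists>D. ((\<lambda>t. f (x + t *\<^sub>R b)) has_real_derivative D) (at 0)"
    using lipschitz_directional_derivative_ae[OF L, of b] by blast
  \<comment> \<open>Approximate gradients come from a countable dense set, so that only countably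
    many null sets are united.\<close>
  obtain Q :: "'a set" where Q: "countable Q" "\<And>X. open X \<Longrightarrow> X \<noteq> {} \<Longrightarrow> \<exists>q\<in>Q. q \<in> X"
    using countable_dense_exists by blast
  \<comment> \<open>Fixing slope, tolerance and radius makes the estimate uniform over the set; the
    conditions on \<open>x\<close> are closed.\<close>
  define A where "A = (\<lambda>q (k::nat) (m::nat). {x. \<forall>w\<in>span B. norm w < 1 / (real m + 1) \<longrightarrow>
    \<bar>f (x + w) - f x - q \<bullet> w\<bar> \<le> 1 / (real k + 1) * norm w})"
  have clA: "closed (A q k m)" for q k m
  proof -
    have "A q k m = (\<Inter>w\<in>{w \<in> span B. norm w < 1 / (real m + 1)}.
        {x. \<bar>f (x + w) - f x - q \<bullet> w\<bar> \<le> 1 / (real k + 1) * norm w})"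
      unfolding A_def by auto
    then show ?thesis
      by (auto intro!: closed_INT closed_Collect_le continuous_intros continuous_on_compose2[OF cont])
  qed
  have "\<forall>q k m. \<exists>Z. negligible Z \<and> (\<forall>x\<in>A q k m - Z. \<forall>e>0. \<exists>d>0. \<forall>t. \<bar>t\<bar> < d \<longrightarrow>
      (\<exists>p\<in>A q k m. dist p (x + t *\<^sub>R b) \<le> e * \<bar>t\<bar>))"
    using closed_nonporous_ae[OF clA] by blast
  then obtain ZZ where ZZ: "\<And>q k m. negligible (ZZ q k m)"
    "\<And>q k m x e. x \<in> A q k m - ZZ q k m \<Longrightarrow> e > 0 \<Longrightarrow> \<exists>d>0. \<forall>t. \<bar>t\<bar> < d \<longrightarrow>
      (\<exists>p\<in>A q k m. dist p (x + t *\<^sub>R b) \<le> e * \<bar>t\<bar>)"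
    by metis
  define Z where "Z = Z0 \<union> Zb \<union> (\<Union>(q, k, m)\<in>Q \<times> UNIV \<times> UNIV. ZZ q k m)"
  have "negligible (\<Union>(q, k, m)\<in>Q \<times> UNIV \<times> UNIV. ZZ q k m)"
    using Q(1) ZZ(1) by (intro negligible_countable_Union) auto
  then have "negligible Z" unfolding Z_def using Z0 Zb by auto
  moreover have "\<exists>a. \<forall>e>0. \<exists>d>0. \<forall>v\<in>span (insert b B).
    norm v < d \<longrightarrow> \<bar>f (x + v) - f x - a \<bullet> v\<bar> \<le> e * norm v" if x: "x \<notin> Z" for x
  proof -
    obtain a0 where a0: "\<And>e. e > 0 \<Longrightarrow> \<exists>d>0. \<forall>w\<in>span B.
        norm w < d \<longrightarrow> \<bar>f (x + w) - f x - a0 \<bullet> w\<bar> \<le> e * norm w"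
      using Z0(2)[of x] x unfolding Z_def by blast
    obtain \<beta> where \<beta>: "((\<lambda>t. f (x + t *\<^sub>R b)) has_real_derivative \<beta>) (at 0)"
      using Zb(2)[of x] x unfolding Z_def by blast
    \<comment> \<open>The correction along \<open>b\<close> makes
      \<open>a \<bullet> b = \<beta>\<close> and keeps \<open>a \<bullet> w = a0 \<bullet> w\<close>
      on \<open>span B\<close>, which is orthogonal to \<open>b\<close>.\<close>
    define a where "a = a0 + (\<beta> - a0 \<bullet> b) *\<^sub>R b"
    have "\<exists>d>0. \<forall>v\<in>span (insert b B). norm v < d \<longrightarrow> \<bar>f (x + v) - f x - a \<bullet> v\<bar> \<le> e * norm v"
      if e: "e > 0" for e
    proof -
      \<comment> \<open>The final estimate collects \<open>2 * L\<close> from two jumps, 1 from the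
        derivative along \<open>b\<close>, and 2 + 2 from the error on \<open>span B\<close> and the
        replacement of \<open>a0\<close> by \<open>q\<close>, using
        \<open>norm w \<le> 2 * norm v\<close>.\<close>
      define \<epsilon> where "\<epsilon> = e / (2 * L + 5)"
      have \<epsilon>: "\<epsilon> > 0" using e L0 by (simp add: \<epsilon>_def)
      obtain k :: nat where k: "1 / (real k + 1) < \<epsilon>"
        using reals_Archimedean[OF \<epsilon>] by (auto simp: inverse_eq_divide add.commute)
      define \<kappa> where "\<kappa> = 1 / (real k + 1)"
      have \<kappa>: "\<kappa> > 0" "\<kappa> \<le> \<epsilon>" using k by (auto simp: \<kappa>_def)
      obtain q where q: "q \<in> Q" "norm (q - a0) \<le> \<kappa> / 2"
        using Q(2)[of "ball a0 (\<kappa> / 2)"] \<kappa> by (auto simp: dist_norm norm_minus_commute less_imp_le)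
      obtain d0 where d0: "d0 > 0" "\<And>w. w \<in> span B \<Longrightarrow> norm w < d0 \<Longrightarrow> \<bar>f (x + w) - f x - a0 \<bullet> w\<bar> \<le> \<kappa> / 2 * norm w"
        using a0[of "\<kappa> / 2"] \<kappa> by auto
      obtain m :: nat where m: "1 / (real m + 1) < d0"
        using reals_Archimedean[OF d0(1)] by (auto simp: inverse_eq_divide add.commute)
      define \<mu> where "\<mu> = 1 / (real m + 1)"
      have \<mu>: "\<mu> > 0" "\<mu> < d0" using m by (auto simp: \<mu>_def)
      have qa: "\<bar>(q - a0) \<bullet> w\<bar> \<le> \<kappa> / 2 * norm w" for w
        using Cauchy_Schwarz_ineq2[of "q - a0" w] mult_right_mono[OF q(2), of "norm w"] by simp
      have "x \<in> A q k m"
      proof -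
        have "\<bar>f (x + w) - f x - q \<bullet> w\<bar> \<le> \<kappa> * norm w" if "w \<in> span B" "norm w < \<mu>" for w
        proof -
          have "q \<bullet> w = a0 \<bullet> w + (q - a0) \<bullet> w" by (simp add: inner_diff_left)
          moreover have "\<bar>f (x + w) - f x - a0 \<bullet> w\<bar> \<le> \<kappa> / 2 * norm w"
            using that \<mu> by (intro d0(2)) auto
          ultimately show ?thesis using qa[of w] by linarith
        qed
        then show ?thesis unfolding A_def \<kappa>_def[symmetric] \<mu>_def[symmetric] by blast
      qed
      moreover have "x \<notin> ZZ q k m" using x q(1) unfolding Z_def by auto
      ultimately obtain d1 where d1: "d1 > 0" "\<And>t. \<bar>t\<bar> < d1 \<Longrightarrow> \<exists>p\<in>A q k m. dist p (x + t *\<^sub>R b) \<le> \<epsilon> * \<bar>t\<bar>"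
        using ZZ(2)[of x q k m \<epsilon>] \<epsilon> by blast
      have "(\<lambda>h. (f (x + h *\<^sub>R b) - f x) / h) \<midarrow>0\<rightarrow> \<beta>" using \<beta> by (simp add: DERIV_def)
      from LIM_D[OF this \<epsilon>] obtain d2 where d2: "d2 > 0"
        "\<And>h. h \<noteq> 0 \<Longrightarrow> \<bar>h\<bar> < d2 \<Longrightarrow> \<bar>(f (x + h *\<^sub>R b) - f x) / h - \<beta>\<bar> < \<epsilon>" by auto
      have d2': "\<bar>f (x + h *\<^sub>R b) - f x - h * \<beta>\<bar> \<le> \<epsilon> * \<bar>h\<bar>" if "\<bar>h\<bar> < d2" for h
      proof (cases "h = 0")
        case False
        have "f (x + h *\<^sub>R b) - f x - h * \<beta> = ((f (x + h *\<^sub>R b) - f x) / h - \<beta>) * h"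
          using False by (simp add: field_simps)
        then show ?thesis using d2(2)[OF False that] by (simp add: abs_mult mult_right_mono)
      qed simp
      define d where "d = min d1 (min d2 (\<mu> / 2))"
      have "\<bar>f (x + v) - f x - a \<bullet> v\<bar> \<le> e * norm v" if v: "v \<in> span (insert b B)" "norm v < d" for v
      proof -
        obtain t where t: "v - t *\<^sub>R b \<in> span B" using v(1) by (auto simp: span_insert)
        define w where "w = v - t *\<^sub>R b"
        have vw: "v = w + t *\<^sub>R b" by (simp add: w_def)
        have wb: "w \<bullet> b = 0" using orth t by (simp add: w_def)
        have "v \<bullet> b = t" using wb b(1) by (simp add: vw inner_add_left inner_same_Basis)
        then have tv: "\<bar>t\<bar> \<le> norm v" using Basis_le_norm[OF b(1), of v] by simp
        then have wv: "norm w \<le> 2 * norm v"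
          using norm_triangle_ineq4[of v "t *\<^sub>R b"] b(1) by (simp add: w_def)
        obtain p where p: "p \<in> A q k m" "norm (p - (x + t *\<^sub>R b)) \<le> \<epsilon> * \<bar>t\<bar>"
          using d1(2)[of t] tv v(2) by (auto simp: d_def dist_norm)
        \<comment> \<open>The increment is followed from \<open>x\<close> through
          \<open>x + t b\<close>, \<open>p\<close> and \<open>p + w\<close> to \<open>x + v\<close>:
          facts 1 and 2 are the jumps, 3 the step in \<open>span B\<close>, 4 the step along
          \<open>b\<close>.\<close>
        have 1: "\<bar>f (x + v) - f (p + w)\<bar> \<le> L * (\<epsilon> * \<bar>t\<bar>)"
        proof -
          have "(x + v) - (p + w) = - (p - (x + t *\<^sub>R b))" by (simp add: vw)
          then have "norm ((x + v) - (p + w)) \<le> \<epsilon> * \<bar>t\<bar>" using p(2) by (metis norm_minus_cancel)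
          then show ?thesis using fl[of "x + v" "p + w"] mult_left_mono[OF _ L0] order_trans by blast
        qed
        have 2: "\<bar>f p - f (x + t *\<^sub>R b)\<bar> \<le> L * (\<epsilon> * \<bar>t\<bar>)"
          using fl[of p "x + t *\<^sub>R b"] mult_left_mono[OF p(2) L0] by linarith
        have 3: "\<bar>f (p + w) - f p - q \<bullet> w\<bar> \<le> \<kappa> * norm w"
        proof -
          have "norm w < \<mu>" using wv v(2) by (simp add: d_def)
          moreover have "w \<in> span B" using t by (simp add: w_def)
          ultimately show ?thesis
            using p(1) unfolding A_def \<kappa>_def[symmetric] \<mu>_def[symmetric] by blast
        qed
        have 4: "\<bar>f (x + t *\<^sub>R b) - f x - t * \<beta>\<bar> \<le> \<epsilon> * \<bar>t\<bar>"
          using tv v(2) by (intro d2') (auto simp: d_def)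
        have 5: "a \<bullet> v = a0 \<bullet> w + t * \<beta>"
        proof -
          have "a \<bullet> v = a0 \<bullet> v + (\<beta> - a0 \<bullet> b) * t"
            using \<open>v \<bullet> b = t\<close> by (simp add: a_def inner_add_left inner_commute[of b v])
          moreover have "a0 \<bullet> v = a0 \<bullet> w + t * (a0 \<bullet> b)"
            by (simp add: vw inner_add_right)
          ultimately show ?thesis by (simp add: algebra_simps)
        qed
        have 6: "(q - a0) \<bullet> w = q \<bullet> w - a0 \<bullet> w" by (simp add: inner_diff_left)
        have "\<bar>f (x + v) - f x - a \<bullet> v\<bar> \<le> 2 * (L * (\<epsilon> * \<bar>t\<bar>)) + \<kappa> * norm w + \<epsilon> * \<bar>t\<bar> + \<kappa> / 2 * norm w"
          using 1 2 3 4 5 6 qa[of w] by linarith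
        also have "\<dots> \<le> 2 * (L * (\<epsilon> * norm v)) + \<epsilon> * (2 * norm v) + \<epsilon> * norm v + \<epsilon> * (2 * norm v)"
          using tv wv \<epsilon> \<kappa> L0 by (intro add_mono mult_mono) auto
        also have "\<dots> = (\<epsilon> * (2 * L + 5)) * norm v" by (simp add: algebra_simps)
        also have "\<epsilon> * (2 * L + 5) = e" using L0 by (simp add: \<epsilon>_def)
        finally show ?thesis .
      qed
      moreover have "d > 0" using d1 d2 \<mu> by (simp add: d_def)
      ultimately show ?thesis by blast
    qed
    then show ?thesis by blast
  qed
  ultimately show ?case by blast
qed

theorem Rademacher:
  fixes F :: "'a::euclidean_space \<Rightarrow> 'b::euclidean_space"
  assumes L: "L-lipschitz_on UNIV F"
  shows "negligible {x. \<not> F differentiable (at x)}"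
proof -
  have "negligible {x. \<not> (\<lambda>y. F y \<bullet> c) differentiable (at x)}" if c: "c \<in> Basis" for c
  proof -
    have "L-lipschitz_on UNIV (\<lambda>y. F y \<bullet> c)"
    proof (rule lipschitz_onI)
      fix x y
      have "dist (F x \<bullet> c) (F y \<bullet> c) \<le> dist (F x) (F y)"
        using Basis_le_norm[OF c, of "F x - F y"] by (simp add: dist_norm inner_diff_left)
      also have "\<dots> \<le> L * dist x y" by (rule lipschitz_onD[OF L UNIV_I UNIV_I])
      finally show "dist (F x \<bullet> c) (F y \<bullet> c) \<le> L * dist x y" .
    qed (rule lipschitz_on_nonneg[OF L])
    from lipschitz_differentiable_on_span_ae[OF this order_refl]
    obtain Z where Z: "negligible Z" "\<And>x. x \<notin> Z \<Longrightarrow> \<exists>a. \<forall>e>0. \<exists>d>0. \<forall>w\<in>span Basis.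
        norm w < d \<longrightarrow> \<bar>F (x + w) \<bullet> c - F x \<bullet> c - a \<bullet> w\<bar> \<le> e * norm w"
      by blast
    have "{x. \<not> (\<lambda>y. F y \<bullet> c) differentiable (at x)} \<subseteq> Z"
    proof (rule ccontr)
      assume "\<not> ?thesis"
      then obtain x where x: "\<not> (\<lambda>y. F y \<bullet> c) differentiable (at x)" "x \<notin> Z" by auto
      then obtain a where a: "\<And>e. e > 0 \<Longrightarrow> \<exists>d>0. \<forall>w\<in>span Basis.
        norm w < d \<longrightarrow> \<bar>F (x + w) \<bullet> c - F x \<bullet> c - a \<bullet> w\<bar> \<le> e * norm w" using Z by blast
      have "((\<lambda>y. F y \<bullet> c) has_derivative (\<lambda>h. a \<bullet> h)) (at x)"
        unfolding has_derivative_at_alt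
      proof (intro conjI allI impI)
        fix e :: real assume "e > 0"
        from a[OF this] obtain d where d: "d > 0"
          "\<And>w. norm w < d \<Longrightarrow> \<bar>F (x + w) \<bullet> c - F x \<bullet> c - a \<bullet> w\<bar> \<le> e * norm w"
          by (auto simp: span_Basis)
        show "\<exists>d>0. \<forall>y. norm (y - x) < d \<longrightarrow>
            norm (F y \<bullet> c - F x \<bullet> c - a \<bullet> (y - x)) \<le> e * norm (y - x)"
        proof (intro exI[of _ d] conjI allI impI)
          fix y assume "norm (y - x) < d"
          then show "norm (F y \<bullet> c - F x \<bullet> c - a \<bullet> (y - x)) \<le> e * norm (y - x)"
            using d(2)[of "y - x"] by simp
        qed (fact d(1))
      qed (rule bounded_linear_inner_right)
      with x show False by (auto simp: differentiable_def)
    qed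
    then show ?thesis using Z negligible_subset by blast
  qed
  then have "negligible (\<Union>c\<in>Basis. {x. \<not> (\<lambda>y. F y \<bullet> c) differentiable (at x)})"
    by (intro negligible_Union) auto
  then show ?thesis
    by (rule negligible_subset) (use differentiable_componentwise_within[of F _ UNIV] in auto)
qed

text \<open>After subtraction of a slope slightly above \<open>d\<close>, the function
  \<open>k\<close> has negative derivative off \<open>Z\<close>, although \<open>k a < k b\<close>.
  Each value strictly between is attained for a last time, where the derivative cannot be negative.
  So the null set \<open>k\<close> applied to \<open>Z\<close> would contain an interval.\<close>

lemma lipschitz_increment_le_if_derivative_le_ae:
  fixes g :: "real \<Rightarrow> real"
  assumes L: "L-lipschitz_on UNIV g" and Z: "negligible Z"
    and D: "\<And>s. s \<notin> Z \<Longrightarrow> \<exists>D\<le>d. (g has_real_derivative D) (at s)" and "a \<le> b"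
  shows "g b - g a \<le> d * (b - a)"
proof (rule ccontr)
  assume n: "\<not> g b - g a \<le> d * (b - a)"
  then have "a \<noteq> b" by auto
  with \<open>a \<le> b\<close> have ab: "a < b" by auto
  \<comment> \<open>Half of the excess slope: \<open>k\<close> still rises by
    \<open>\<eta> * (b - a)\<close>, yet its derivative off \<open>Z\<close> is at most
    \<open>- \<eta>\<close>.\<close>
  define \<eta> where "\<eta> = ((g b - g a) - d * (b - a)) / (2 * (b - a))"
  have \<eta>: "\<eta> > 0" using n ab by (auto simp: \<eta>_def)
  define k where "k = (\<lambda>s. g s - (d + \<eta>) * s)"
  have "k b - k a = (g b - g a) - d * (b - a) - \<eta> * (b - a)" by (simp add: k_def algebra_simps)
  also have "\<dots> = \<eta> * (b - a)" using ab by (simp add: \<eta>_def field_simps)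
  finally have "k b - k a = \<eta> * (b - a)" .
  moreover have "\<eta> * (b - a) > 0" using \<eta> ab by simp
  ultimately have kab: "k a < k b" by linarith
  have klip: "\<bar>k x - k y\<bar> \<le> (L + \<bar>d + \<eta>\<bar>) * \<bar>x - y\<bar>" for x y
  proof -
    have "k x - k y = (g x - g y) - (d + \<eta>) * (x - y)" by (simp add: k_def algebra_simps)
    then have "\<bar>k x - k y\<bar> \<le> \<bar>g x - g y\<bar> + \<bar>d + \<eta>\<bar> * \<bar>x - y\<bar>"
      unfolding abs_mult[symmetric] by linarith
    then show ?thesis
      using lipschitz_onD[OF L UNIV_I UNIV_I, of x y] by (simp add: dist_real_def distrib_right)
  qed
  have kc: "continuous_on A k" for A
    unfolding k_def using lipschitz_on_continuous_on[OF L] continuous_on_subset[of UNIV g A]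
    by (intro continuous_intros) auto
  have "{k a<..<k b} \<subseteq> k ` Z"
  proof
    fix y assume y: "y \<in> {k a<..<k b}"
    define S where "S = {s \<in> {a..b}. k s = y}"
    have "compact S"
      unfolding S_def compact_eq_bounded_closed
      using continuous_closed_preimage_constant[OF kc[of "{a..b}"]]
      by (auto intro: bounded_subset[of "{a..b}"])
    moreover have "S \<noteq> {}"
      using IVT'[OF _ _ _ kc, of a y b] y ab by (auto simp: S_def)
    ultimately have "\<exists>s\<in>S. \<forall>r\<in>S. r \<le> s"
      by (rule compact_attains_sup)
    then obtain s where s: "s \<in> S" "\<And>r. r \<in> S \<Longrightarrow> r \<le> s" by blast
    have sb: "s < b" "a \<le> s" "k s = y" using s(1) y by (auto simp: S_def less_le)
    \<comment> \<open>A later value not above \<open>y\<close> would, as \<open>k b > y\<close>,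
      force a solution of \<open>k r = y\<close> after the last one.\<close>
    have gt: "k r > y" if r: "s < r" "r \<le> b" for r
    proof (rule ccontr)
      assume "\<not> k r > y"
      then obtain r' where "r \<le> r'" "r' \<le> b" "k r' = y"
        using IVT'[OF _ _ _ kc, of r y b] y r by auto
      then show False using s(2)[of r'] r sb by (auto simp: S_def)
    qed
    have "s \<in> Z"
    proof (rule ccontr)
      assume "s \<notin> Z"
      then obtain D where "D \<le> d" "(g has_real_derivative D) (at s)" using D by blast
      then have "(k has_real_derivative (D - (d + \<eta>) * 1)) (at s)"
        unfolding k_def by (intro DERIV_diff DERIV_cmult DERIV_ident)
      moreover have "D - (d + \<eta>) * 1 < 0" using \<open>D \<le> d\<close> \<eta> by simp
      ultimately obtain \<delta> where \<delta>: "\<delta> > 0" "\<And>h. 0 < h \<Longrightarrow> h < \<delta> \<Longrightarrow> k (s + h) < k s"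
        using DERIV_neg_dec_right by blast
      define h where "h = min (\<delta> / 2) (b - s)"
      have "0 < h" "h < \<delta>" "s + h \<le> b" using \<delta>(1) sb by (auto simp: h_def)
      then show False using \<delta>(2)[of h] gt[of "s + h"] sb by auto
    qed
    then show "y \<in> k ` Z" using sb by auto
  qed
  moreover have "negligible (k ` Z)"
    by (rule negligible_locally_Lipschitz_image[OF _ Z])
      (auto intro!: exI[of _ "UNIV :: real set"] exI[of _ "L + \<bar>d + \<eta>\<bar>"] klip)
  ultimately have "negligible {k a<..<k b}" using negligible_subset by blast
  then show False using open_not_negligible[of "{k a<..<k b}"] kab by simp
qed

text \<open>By Rademacher and Fubini, \<open>F\<close> is differentiable almost everywhere on almost
  every line parallel to \<open>b\<close>, so the bound on the line applies to almost every starting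
  point.\<close>

lemma lipschitz_directional_increment_le:
  fixes F :: "'a::euclidean_space \<Rightarrow> 'b::euclidean_space"
  assumes L: "L-lipschitz_on UNIV F"
    and d: "\<And>x. F differentiable (at x) \<Longrightarrow> frechet_derivative F (at x) b \<bullet> c \<le> d" and t: "t \<ge> 0"
  shows "(F (x + t *\<^sub>R b) - F x) \<bullet> c \<le> d * t"
proof -
  obtain Z where Z: "negligible Z"
    "\<And>x. x \<notin> Z \<Longrightarrow> negligible {s::real. x + s *\<^sub>R b \<in> {x. \<not> F differentiable (at x)}}"
    using negligible_on_almost_all_lines[OF Rademacher[OF L], of b] by blast
  have off: "(F (x + t *\<^sub>R b) - F x) \<bullet> c \<le> d * t" if x: "x \<notin> Z" for x
  proof -
    define g where "g = (\<lambda>s. F (x + s *\<^sub>R b) \<bullet> c)"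
    have "(L * norm b * norm c)-lipschitz_on UNIV g"
    proof (rule lipschitz_onI)
      fix s r :: real
      have "dist (g s) (g r) \<le> dist (F (x + s *\<^sub>R b)) (F (x + r *\<^sub>R b)) * norm c"
        unfolding g_def dist_norm inner_diff_left[symmetric] using Cauchy_Schwarz_ineq2 by auto
      also have "\<dots> \<le> (L * dist (x + s *\<^sub>R b) (x + r *\<^sub>R b)) * norm c"
        by (intro mult_right_mono lipschitz_onD[OF L UNIV_I UNIV_I]) auto
      also have "dist (x + s *\<^sub>R b) (x + r *\<^sub>R b) = norm b * dist s r"
        by (simp add: dist_norm scaleR_diff_left[symmetric] mult.commute)
      finally show "dist (g s) (g r) \<le> L * norm b * norm c * dist s r" by (simp add: mult_ac)
    qed (use lipschitz_on_nonneg[OF L] in auto)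
    moreover have "\<exists>D\<le>d. (g has_real_derivative D) (at s)"
      if "s \<notin> {s::real. x + s *\<^sub>R b \<in> {x. \<not> F differentiable (at x)}}" for s
    proof -
      have diff: "F differentiable (at (x + s *\<^sub>R b))" using that by auto
      define F' where "F' = frechet_derivative F (at (x + s *\<^sub>R b))"
      have F': "(F has_derivative F') (at (x + s *\<^sub>R b))"
        unfolding F'_def using diff frechet_derivative_works by blast
      then have lin: "linear F'" by (rule has_derivative_linear)
      have "((\<lambda>s. x + s *\<^sub>R b) has_derivative (\<lambda>h. h *\<^sub>R b)) (at s)"
        by (auto intro!: derivative_eq_intros)
      from has_derivative_compose[OF this F']
      have "((\<lambda>s. F (x + s *\<^sub>R b)) has_derivative (\<lambda>h. F' (h *\<^sub>R b))) (at s)" .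
      from has_derivative_inner_left[OF this, of c]
      have "(g has_derivative (\<lambda>h. F' (h *\<^sub>R b) \<bullet> c)) (at s)" by (simp add: g_def)
      moreover have "(\<lambda>h. F' (h *\<^sub>R b) \<bullet> c) = (*) (F' b \<bullet> c)"
        using lin by (auto simp: linear_scale mult.commute)
      ultimately have "(g has_real_derivative (F' b \<bullet> c)) (at s)"
        by (simp add: has_field_derivative_def)
      then show ?thesis using d[OF diff] by (auto simp: F'_def)
    qed
    ultimately have "g t - g 0 \<le> d * (t - 0)"
      using lipschitz_increment_le_if_derivative_le_ae[OF _ Z(2)[OF x] _ t] by blast
    then show ?thesis by (simp add: g_def inner_diff_left)
  qed
  have cont: "continuous_on UNIV F" using L by (rule lipschitz_on_continuous_on)
  \<comment> \<open>The violating starting points form an open set by continuity; being contained in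
    a null set, it is empty.\<close>
  define U where "U = {x. d * t < (F (x + t *\<^sub>R b) - F x) \<bullet> c}"
  have "open U" unfolding U_def
    by (intro open_Collect_less continuous_intros continuous_on_compose2[OF cont]) auto
  moreover have "U \<subseteq> Z" using off by (force simp: U_def)
  ultimately have "U = {}"
    using open_not_negligible Z(1) negligible_subset by blast
  then show ?thesis by (simp add: U_def set_eq_iff not_less)
qed

section \<open>Norms, resolvents and the forward step\<close>

text \<open>The range is open by invariance of domain, and closed because preimages of a convergent
  sequence form a Cauchy sequence; connectedness makes it everything.\<close>

lemma expanding_imp_bij:
  fixes G :: "'a::euclidean_space \<Rightarrow> 'a"
  assumes G: "continuous_on UNIV G" and a: "a > 0"
    and ex: "\<And>x y. a * norm (x - y) \<le> norm (G x - G y)"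
  shows "bij G"
proof -
  have inj: "inj G"
  proof (rule injI)
    fix x y assume "G x = G y"
    then have "a * norm (x - y) \<le> 0" using ex[of x y] by simp
    then show "x = y" using a by (simp add: mult_le_0_iff)
  qed
  have "open (range G)" using invariance_of_domain[OF G open_UNIV inj] .
  moreover have "closed (range G)"
    unfolding closed_sequential_limits
  proof (intro allI impI, elim conjE)
    fix z y assume z: "\<forall>n. z n \<in> range G" "z \<longlonglongrightarrow> y"
    then have "\<forall>n. \<exists>x. z n = G x" by auto
    then obtain x where x: "z n = G (x n)" for n by metis
    have "Cauchy x"
    proof (rule CauchyI)
      fix e :: real assume e: "e > 0"
      obtain M where M: "\<And>m n. m \<ge> M \<Longrightarrow> n \<ge> M \<Longrightarrow> norm (z m - z n) < a * e"
        using CauchyD[OF LIMSEQ_imp_Cauchy[OF z(2)], of "a * e"] a e by auto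
      have "norm (x m - x n) < e" if "m \<ge> M" "n \<ge> M" for m n
      proof -
        have "a * norm (x m - x n) < a * e"
          using ex[of "x m" "x n"] M[OF that] by (simp add: x)
        then show ?thesis using a by simp
      qed
      then show "\<exists>M. \<forall>m\<ge>M. \<forall>n\<ge>M. norm (x m - x n) < e" by blast
    qed
    then obtain x' where x': "x \<longlonglongrightarrow> x'" using Cauchy_convergent_iff convergentD by blast
    have "(\<lambda>n. G (x n)) \<longlonglongrightarrow> G x'"
      using continuous_on_tendsto_compose[OF G x'] by simp
    then have "z \<longlonglongrightarrow> G x'" unfolding x[symmetric] .
    then have "G x' = y" using z(2) LIMSEQ_unique by blast
    then show "y \<in> range G" by auto
  qed
  ultimately have "range G = UNIV" using clopen[of "range G"] by auto
  then show ?thesis using inj by (simp add: bij_def)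
qed

lemma contraction_factor_limit:
  fixes a :: "nat \<Rightarrow> real"
  assumes a0: "\<And>k. a k \<ge> 0" and q: "\<And>k. a (Suc k) \<le> q * a k" "q < 1"
  shows "a \<longlonglongrightarrow> 0"
proof -
  define r where "r = max q 0"
  have r: "0 \<le> r" "r < 1" using q by (auto simp: r_def)
  have le: "a k \<le> a 0 * r ^ k" for k
  proof (induction k)
    case (Suc k)
    have "a (Suc k) \<le> r * a k"
      using q(1)[of k] mult_right_mono[OF _ a0[of k], of q r] by (simp add: r_def)
    also have "\<dots> \<le> r * (a 0 * r ^ k)" using Suc r by (intro mult_left_mono) auto
    finally show ?case by (simp add: mult_ac)
  qed simp
  have "(\<lambda>k. a 0 * r ^ k) \<longlonglongrightarrow> a 0 * 0"
    using r by (intro tendsto_mult tendsto_const LIMSEQ_power_zero) auto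
  then show ?thesis
    by (intro tendsto_sandwich[of "\<lambda>_. 0" a sequentially "\<lambda>k. a 0 * r ^ k" 0])
      (auto simp: a0 le intro: always_eventually)
qed

section \<open>Arbitrary norms and their equivalence with the Euclidean norm\<close>

locale norm_function =
  fixes N :: "real^'n \<Rightarrow> real"
  assumes is_norm: "is_norm N"
begin

lemma N_nonneg [simp]: "N x \<ge> 0"
  and N_eq_0 [simp]: "N x = 0 \<longleftrightarrow> x = 0"
  and N_scale: "N (a *\<^sub>R x) = \<bar>a\<bar> * N x"
  and N_triangle: "N (x + y) \<le> N x + N y"
  using is_norm by (auto simp: is_norm_def)

lemma N_zero [simp]: "N 0 = 0"
  by simp

lemma N_minus [simp]: "N (- x) = N x"
  using N_scale[of "-1" x] by simp

lemma N_minus_commute: "N (x - y) = N (y - x)"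
  using N_minus[of "x - y"] by simp

lemma N_triangle_diff: "N (x - z) \<le> N (x - y) + N (y - z)"
  using N_triangle[of "x - y" "y - z"] by simp

lemma N_upper: obtains K where "K > 0" "\<And>x. N x \<le> K * norm x"
proof
  define K where "K = 1 + (\<Sum>i\<in>UNIV. N (axis i 1))"
  show "K > 0" unfolding K_def by (intro add_pos_nonneg sum_nonneg) auto
  fix x
  have sub: "N (\<Sum>i\<in>S. x $ i *\<^sub>R axis i 1) \<le> (\<Sum>i\<in>S. norm x * N (axis i 1))" if "finite S" for S
    using that
  proof induction
    case (insert i S)
    have "N (x $ i *\<^sub>R axis i 1) \<le> norm x * N (axis i 1)"
      unfolding N_scale by (intro mult_right_mono component_le_norm_cart) auto
    then show ?case using insert N_triangle[of "x $ i *\<^sub>R axis i 1" "\<Sum>i\<in>S. x $ i *\<^sub>R axis i 1"] by simp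
  qed simp
  have "x = (\<Sum>i\<in>UNIV. x $ i *\<^sub>R axis i 1)"
    using basis_expansion[of x] by (simp add: scalar_mult_eq_scaleR)
  then have "N x \<le> (\<Sum>i\<in>UNIV. norm x * N (axis i 1))"
    using sub[of UNIV] by simp
  also have "\<dots> \<le> K * norm x"
    by (simp add: K_def sum_distrib_left[symmetric] algebra_simps)
  finally show "N x \<le> K * norm x" .
qed

lemma N_abs_diff: "\<bar>N x - N y\<bar> \<le> N (x - y)"
  using N_triangle[of "x - y" y] N_triangle[of "y - x" x] N_minus_commute[of x y] by simp

lemma N_continuous: "continuous_on S N"
proof -
  obtain K where K: "K > 0" "\<And>x. N x \<le> K * norm x" using N_upper by blast
  have "K-lipschitz_on S N"
    by (rule lipschitz_onI)
      (use K in \<open>auto simp: dist_norm intro: order_trans[OF N_abs_diff]\<close>)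
  then show ?thesis by (rule lipschitz_on_continuous_on)
qed

lemma N_lower: obtains K where "K > 0" "\<And>x. norm x \<le> K * N x"
proof -
  have "sphere (0 :: real^'n) 1 \<noteq> {}"
    using norm_axis_1[of undefined] by (metis dist_0_norm empty_iff mem_sphere)
  then obtain z :: "real^'n" where z: "norm z = 1" "\<And>x. norm x = 1 \<Longrightarrow> N z \<le> N x"
    using continuous_attains_inf[OF compact_sphere _ N_continuous, of 0 1] by auto
  have zp: "N z > 0" using z(1) N_nonneg[of z] by (auto simp: less_le simp del: N_nonneg)
  show ?thesis
  proof
    show "1 / N z > 0" using zp by simp
    fix x
    show "norm x \<le> 1 / N z * N x"
    proof (cases "x = 0")
      case False
      then have "N z \<le> N ((1 / norm x) *\<^sub>R x)" by (intro z(2)) simp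
      then show ?thesis using False zp unfolding N_scale by (simp add: field_simps)
    qed simp
  qed
qed

lemma lipschitz_wrt_imp_lipschitz_on:
  assumes "lipschitz_wrt N l F"
  shows "\<exists>K. K-lipschitz_on UNIV F"
proof -
  have l: "l \<ge> 0" "\<And>x y. N (F x - F y) \<le> l * N (x - y)" using assms by (auto simp: lipschitz_wrt_def)
  obtain K where K: "K > 0" "\<And>x. norm x \<le> K * N x" using N_lower by blast
  obtain M where M: "M > 0" "\<And>x. N x \<le> M * norm x" using N_upper by blast
  have "(K * (l * M))-lipschitz_on UNIV F"
  proof (rule lipschitz_onI)
    fix x y
    have "norm (F x - F y) \<le> K * N (F x - F y)" by (rule K)
    also have "\<dots> \<le> K * (l * N (x - y))" using K l by (intro mult_left_mono) auto
    also have "\<dots> \<le> K * (l * (M * norm (x - y)))" using K l M by (intro mult_left_mono) auto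
    finally show "dist (F x) (F y) \<le> K * (l * M) * dist x y" by (simp add: dist_norm mult_ac)
  qed (use K l M in auto)
  then show ?thesis by blast
qed

lemma N_expanding_imp_bij:
  assumes G: "continuous_on UNIV G" and a: "a > 0" and ex: "\<And>x y. a * N (x - y) \<le> N (G x - G y)"
  shows "bij G"
proof -
  obtain K where K: "K > 0" "\<And>x. norm x \<le> K * N x" using N_lower by blast
  obtain M where M: "M > 0" "\<And>x. N x \<le> M * norm x" using N_upper by blast
  show ?thesis
  proof (rule expanding_imp_bij[OF G])
    show "a / (K * M) > 0" using a K M by simp
    fix x y
    have "a * norm (x - y) \<le> K * (a * N (x - y))"
      using mult_left_mono[OF K(2)[of "x - y"] less_imp_le[OF a]] by (simp add: mult_ac)
    also have "\<dots> \<le> K * (M * norm (G x - G y))"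
      using K ex[of x y] M(2)[of "G x - G y"] by (intro mult_left_mono) auto
    finally show "a / (K * M) * norm (x - y) \<le> norm (G x - G y)"
      using K M by (simp add: field_simps)
  qed
qed

text \<open>These are the consequences through which monotonicity enters everything below.
  Cauchy-Schwarz bounds the pairing from above, and one factor \<open>N (x - y)\<close> is
  cancelled.\<close>

lemma norm_monotoneD:
  assumes "norm_monotone N c F"
  shows "c \<ge> 0" and "a \<ge> 0 \<Longrightarrow> (1 + a * c) * N (x - y) \<le> N (x - y + a *\<^sub>R (F x - F y))"
    and "c * N (x - y) \<le> N (F x - F y)"
proof -
  obtain wp where c: "c \<ge> 0" and wp: "compatible_wp N wp"
    and m: "\<And>x y. - wp (- (F x - F y)) (x - y) \<ge> c * (N (x - y))\<^sup>2"
    using assms by (auto simp: norm_monotone_def)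
  have W: "weak_pairing wp" and sq: "\<And>x. wp x x = (N x)\<^sup>2" using wp by (auto simp: compatible_wp_def)
  have add: "wp (x1 + x2) y \<le> wp x1 y + wp x2 y" for x1 x2 y using W by (simp add: weak_pairing_def)
  have sc: "a \<ge> 0 \<Longrightarrow> wp (a *\<^sub>R x) y = a * wp x y" for a x y using W by (simp add: weak_pairing_def)
  have "\<bar>wp x y\<bar> \<le> sqrt (wp x x) * sqrt (wp y y)" for x y using W by (simp add: weak_pairing_def)
  then have cs: "\<bar>wp x y\<bar> \<le> N x * N y" for x y by (simp add: sq)
  show "c \<ge> 0" by fact
  have canc: "A * N u \<le> B" if "A * (N u)\<^sup>2 \<le> B * N u" "B \<ge> 0" for A B u
  proof (cases "N u = 0")
    case False
    then have "N u > 0" by (simp add: less_le)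
    moreover have "(A * N u) * N u \<le> B * N u" using that by (simp add: power2_eq_square mult_ac)
    ultimately show ?thesis by (metis mult_le_cancel_right_pos)
  qed (use that in simp)
  show "(1 + a * c) * N (x - y) \<le> N (x - y + a *\<^sub>R (F x - F y))" if a: "a \<ge> 0"
  proof (rule canc)
    define u where "u = x - y"
    define v where "v = F x - F y"
    \<comment> \<open>Subadditivity for \<open>u = (u + a v) + a (- v)\<close>. The pairing need not
      be odd in its first argument, so the sign stays inside, in the form in which monotonicity
      provides it.\<close>
    have "(N u)\<^sup>2 \<le> wp (u + a *\<^sub>R v) u + wp (a *\<^sub>R (- v)) u"
      using add[of "u + a *\<^sub>R v" "a *\<^sub>R (- v)" u] by (simp add: sq)
    also have "wp (a *\<^sub>R (- v)) u = a * wp (- v) u" by (rule sc[OF a])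
    also have "\<dots> \<le> - (a * (c * (N u)\<^sup>2))"
      using mult_left_mono[OF m[of x y] a] by (simp add: u_def v_def)
    finally show "(1 + a * c) * (N (x - y))\<^sup>2 \<le> N (x - y + a *\<^sub>R (F x - F y)) * N (x - y)"
      using cs[of "u + a *\<^sub>R v" u] unfolding u_def v_def by (simp add: algebra_simps)
  qed simp
  show "c * N (x - y) \<le> N (F x - F y)"
  proof (rule canc)
    show "c * (N (x - y))\<^sup>2 \<le> N (F x - F y) * N (x - y)"
      using m[where x=x and y=y] cs[of "- (F x - F y)" "x - y"] N_minus_commute[of "F x" "F y"] by simp
  qed simp
qed

end

section \<open>Resolvents, the forward step and the Cayley map\<close>

locale monotone_map = norm_function N for N :: "real^'n \<Rightarrow> real" +
  fixes F :: "real^'n \<Rightarrow> real^'n" and l c :: real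
  assumes lip: "lipschitz_wrt N l F"
    and monotone: "norm_monotone N c F"
begin

lemma l_nonneg: "l \<ge> 0" and F_lip: "N (F x - F y) \<le> l * N (x - y)"
  using lip by (auto simp: lipschitz_wrt_def)

lemmas c_nonneg = norm_monotoneD(1)[OF monotone]
lemmas expansive = norm_monotoneD(2)[OF monotone]
lemmas F_expansive = norm_monotoneD(3)[OF monotone]

lemma F_continuous: "continuous_on S F"
proof -
  have "continuous_on UNIV F"
    using lipschitz_wrt_imp_lipschitz_on[OF lip] lipschitz_on_continuous_on by blast
  then show ?thesis using continuous_on_subset by blast
qed

lemma unique_zero: assumes "c > 0" obtains xs where "F xs = 0" "\<And>z. F z = 0 \<Longrightarrow> z = xs"
proof -
  have "bij F" using F_continuous assms F_expansive by (rule N_expanding_imp_bij)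
  then have "\<exists>!x. F x = 0" by (simp add: bij_iff)
  then show ?thesis using that by blast
qed

lemma resolvent_ex1: assumes "\<alpha> > 0" shows "\<exists>!x. x + \<alpha> *\<^sub>R F x = y"
proof -
  have "bij (\<lambda>x. x + \<alpha> *\<^sub>R F x)"
  proof (rule N_expanding_imp_bij)
    show "continuous_on UNIV (\<lambda>x. x + \<alpha> *\<^sub>R F x)" by (intro continuous_intros F_continuous)
    fix x y
    have "1 * N (x - y) \<le> (1 + \<alpha> * c) * N (x - y)"
      using assms c_nonneg by (intro mult_right_mono) auto
    also have "\<dots> \<le> N (x - y + \<alpha> *\<^sub>R (F x - F y))" using assms by (intro expansive) simp
    finally show "1 * N (x - y) \<le> N (x + \<alpha> *\<^sub>R F x - (y + \<alpha> *\<^sub>R F y))"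
      by (simp add: algebra_simps)
  qed simp
  then show ?thesis by (simp add: bij_iff)
qed

lemma resolvent: "\<alpha> > 0 \<Longrightarrow> resolvent \<alpha> F y + \<alpha> *\<^sub>R F (resolvent \<alpha> F y) = y"
  unfolding resolvent_def by (rule theI'[OF resolvent_ex1])

lemma resolvent_eqI: "\<alpha> > 0 \<Longrightarrow> x + \<alpha> *\<^sub>R F x = y \<Longrightarrow> resolvent \<alpha> F y = x"
  unfolding resolvent_def by (rule the1_equality[OF resolvent_ex1])

lemma resolvent_contraction:
  assumes "\<alpha> > 0"
  shows "N (resolvent \<alpha> F x - resolvent \<alpha> F y) \<le> N (x - y) / (1 + \<alpha> * c)"
proof -
  have "(1 + \<alpha> * c) * N (resolvent \<alpha> F x - resolvent \<alpha> F y) \<le>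
     N (resolvent \<alpha> F x - resolvent \<alpha> F y + \<alpha> *\<^sub>R (F (resolvent \<alpha> F x) - F (resolvent \<alpha> F y)))"
    using assms by (intro expansive) simp
  also have "\<dots> = N ((resolvent \<alpha> F x + \<alpha> *\<^sub>R F (resolvent \<alpha> F x)) - (resolvent \<alpha> F y + \<alpha> *\<^sub>R F (resolvent \<alpha> F y)))"
    by (simp add: algebra_simps)
  also have "\<dots> = N (x - y)" by (simp only: resolvent[OF assms])
  finally show ?thesis
    using assms c_nonneg by (simp add: pos_le_divide_eq add_pos_nonneg mult.commute)
qed

lemma cayley_eq: "\<alpha> > 0 \<Longrightarrow> cayley \<alpha> F x = resolvent \<alpha> F x - \<alpha> *\<^sub>R F (resolvent \<alpha> F x)"
proof -
  assume "\<alpha> > 0"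
  then have "x - resolvent \<alpha> F x = \<alpha> *\<^sub>R F (resolvent \<alpha> F x)"
    by (metis resolvent add_diff_cancel_left')
  then show ?thesis by (simp add: cayley_def scaleR_2 flip: \<open>x - resolvent \<alpha> F x = _\<close>)
qed

text \<open>The points \<open>z k\<close> are implicit Euler steps of size \<open>h\<close> from
  \<open>x\<close>, each contracting towards \<open>xs\<close> by \<open>q\<close>. The forward step
  is the explicit counterpart of \<open>n\<close> of them; the two differ because the implicit steps
  use \<open>F (z k)\<close> in place of \<open>F x\<close>, an effect of second order in
  \<open>a\<close>.\<close>

lemma forward_step_n:
  assumes a: "a > 0" and xs: "F xs = 0" and n: "n > 0"
  shows "N (x - a *\<^sub>R F x - xs) \<le> ((1 / (1 + a * c / real n)) ^ n + a\<^sup>2 * l\<^sup>2 / 2 * (1 + 1 / real n)) * N (x - xs)"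
proof -
  define h where "h = a / real n"
  have h: "h > 0" using a n by (simp add: h_def)
  define z where "z = (\<lambda>k. (resolvent h F ^^ k) x)"
  define R where "R = N (x - xs)"
  have R: "R \<ge> 0" by (simp add: R_def)
  define q where "q = 1 / (1 + h * c)"
  have "h * c \<ge> 0" using h c_nonneg by simp
  then have q: "0 \<le> q" "q \<le> 1" by (auto simp: q_def)
  have fp: "resolvent h F xs = xs" using h xs by (intro resolvent_eqI) auto
  have zS: "z (Suc k) + h *\<^sub>R F (z (Suc k)) = z k" for k
    using resolvent[OF h] by (simp add: z_def)
  have zR: "N (z k - xs) \<le> q ^ k * R" for k
  proof (induction k)
    case (Suc k)
    have "N (z (Suc k) - xs) \<le> q * N (z k - xs)"
      using resolvent_contraction[OF h, of "z k" xs] by (simp add: fp z_def q_def)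
    also have "\<dots> \<le> q * (q ^ k * R)" using Suc q by (intro mult_left_mono)
    finally show ?case by simp
  qed (simp add: z_def R_def)
  have Fz: "N (F (z k)) \<le> l * R" for k
  proof -
    have "N (F (z k)) \<le> l * N (z k - xs)" using F_lip[of "z k" xs] xs by simp
    also have "\<dots> \<le> l * (1 * R)"
      using l_nonneg zR[of k] q R by (intro mult_left_mono order_trans[OF zR] mult_right_mono power_le_one) auto
    finally show ?thesis by simp
  qed
  have zx: "N (z k - x) \<le> h * real k * (l * R)" for k
  proof (induction k)
    case (Suc k)
    have "z (Suc k) - x = (z k - x) + (- h) *\<^sub>R F (z (Suc k))" using zS[of k] by (simp add: algebra_simps)
    then have "N (z (Suc k) - x) \<le> N (z k - x) + N ((- h) *\<^sub>R F (z (Suc k)))" by (metis N_triangle)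
    also have "\<dots> \<le> h * real k * (l * R) + h * (l * R)"
      unfolding N_scale using Suc h Fz[of "Suc k"] by (intro add_mono) (auto intro: mult_left_mono)
    finally show ?case by (simp add: algebra_simps)
  qed (simp add: z_def)
  \<comment> \<open>\<open>e k\<close> compares the implicit orbit with uniform motion at velocity
    \<open>- F x\<close>; as \<open>h * n = a\<close>, that motion reaches the forward step at
    \<open>k = n\<close>.\<close>
  define e where "e = (\<lambda>k. z k - (x - (h * real k) *\<^sub>R F x))"
  \<comment> \<open>Passing from \<open>k\<close> to \<open>k + 1\<close> adds at most
    \<open>h^2 * l^2 * R * (k + 1)\<close>; the bound sums the integers up to
    \<open>k\<close>.\<close>
  have eb: "N (e k) \<le> h\<^sup>2 * l\<^sup>2 * R * (real k * (real k + 1) / 2)" for k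
  proof (induction k)
    case (Suc k)
    have "e (Suc k) = e k + h *\<^sub>R (F x - F (z (Suc k)))"
      using zS[of k] by (simp add: e_def algebra_simps)
    then have "N (e (Suc k)) \<le> N (e k) + h * N (F x - F (z (Suc k)))"
      using N_triangle[of "e k" "h *\<^sub>R (F x - F (z (Suc k)))"] h by (simp add: N_scale)
    also have "N (F x - F (z (Suc k))) \<le> l * (h * real (Suc k) * (l * R))"
      using F_lip[of x "z (Suc k)"] mult_left_mono[OF zx[of "Suc k"] l_nonneg] N_minus_commute[of x] by simp
    finally have "N (e (Suc k)) \<le> N (e k) + h * (l * (h * real (Suc k) * (l * R)))" using h by simp
    with Suc show ?case by (simp add: field_simps power2_eq_square)
  qed (simp add: e_def z_def)
  have "x - a *\<^sub>R F x - xs = (z n - xs) + (- e n)" using n by (simp add: e_def h_def)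
  then have "N (x - a *\<^sub>R F x - xs) \<le> N (z n - xs) + N (e n)" by (metis N_triangle N_minus)
  also have "\<dots> \<le> q ^ n * R + h\<^sup>2 * l\<^sup>2 * R * (real n * (real n + 1) / 2)" using zR eb by (intro add_mono)
  also have "h\<^sup>2 * l\<^sup>2 * R * (real n * (real n + 1) / 2) = a\<^sup>2 * l\<^sup>2 / 2 * (1 + 1 / real n) * R"
    using n by (simp add: h_def field_simps power2_eq_square)
  finally show ?thesis by (simp add: q_def h_def R_def algebra_simps)
qed

lemma forward_step:
  assumes a: "a > 0" and xs: "F xs = 0"
  shows "N (x - a *\<^sub>R F x - xs) \<le> (exp (- a * c) + exp (a * l) - 1 - a * l) * N (x - xs)"
proof -
  have "(\<lambda>n. (1 + (a * c) / real n) ^ n) \<longlonglongrightarrow> exp (a * c)" by (rule tendsto_exp_limit_sequentially)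
  then have "(\<lambda>n. inverse ((1 + (a * c) / real n) ^ n)) \<longlonglongrightarrow> inverse (exp (a * c))"
    by (intro tendsto_inverse) auto
  then have 1: "(\<lambda>n. (1 / (1 + a * c / real n)) ^ n) \<longlonglongrightarrow> exp (- a * c)"
    by (simp add: exp_minus inverse_eq_divide power_one_over)
  have 2: "(\<lambda>n. a\<^sup>2 * l\<^sup>2 / 2 * (1 + 1 / real n)) \<longlonglongrightarrow> a\<^sup>2 * l\<^sup>2 / 2 * (1 + 0)"
    by (intro tendsto_intros lim_1_over_n)
  have "(\<lambda>n. ((1 / (1 + a * c / real n)) ^ n + a\<^sup>2 * l\<^sup>2 / 2 * (1 + 1 / real n)) * N (x - xs))
      \<longlonglongrightarrow> (exp (- a * c) + a\<^sup>2 * l\<^sup>2 / 2 * (1 + 0)) * N (x - xs)"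
    by (intro tendsto_mult tendsto_add 1 2 tendsto_const)
  then have "N (x - a *\<^sub>R F x - xs) \<le> (exp (- a * c) + a\<^sup>2 * l\<^sup>2 / 2 * (1 + 0)) * N (x - xs)"
    by (rule LIMSEQ_le_const) (use forward_step_n[OF a xs] in \<open>auto intro!: exI[of _ 1]\<close>)
  \<comment> \<open>The limiting error is the quadratic Taylor term of \<open>exp (a * l)\<close>,
    which is below the full remainder since \<open>a * l \<ge> 0\<close>.\<close>
  also have "\<dots> \<le> (exp (- a * c) + exp (a * l) - 1 - a * l) * N (x - xs)"
    using exp_lower_Taylor_quadratic[of "a * l"] a l_nonneg
    by (intro mult_right_mono) (auto simp: power_mult_distrib)
  finally show ?thesis .
qed

lemma cayley_step:
  assumes \<alpha>: "\<alpha> > 0" and xs: "F xs = 0"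
    and E: "\<And>x. N (x - \<alpha> *\<^sub>R F x - xs) \<le> E * N (x - xs)" and "E \<ge> 0"
  shows "N (cayley \<alpha> F x - xs) \<le> E / (1 + \<alpha> * c) * N (x - xs)"
proof -
  have fp: "resolvent \<alpha> F xs = xs" using \<alpha> xs by (intro resolvent_eqI) auto
  have "N (cayley \<alpha> F x - xs) \<le> E * N (resolvent \<alpha> F x - xs)"
    unfolding cayley_eq[OF \<alpha>] by (rule E)
  also have "\<dots> \<le> E * (N (x - xs) / (1 + \<alpha> * c))"
    using resolvent_contraction[OF \<alpha>, of x xs] fp \<open>E \<ge> 0\<close> by (intro mult_left_mono) auto
  finally show ?thesis by simp
qed

lemma cayley_iteration:
  assumes "\<alpha> > 0" and "F xs = 0"
    and "\<And>x. N (cayley \<alpha> F x - xs) \<le> q * N (x - xs)" and "q < 1"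
  shows "(\<lambda>k. N ((cayley \<alpha> F ^^ k) x0 - xs)) \<longlonglongrightarrow> 0"
    and "N ((cayley \<alpha> F ^^ Suc k) x0 - xs) \<le> q * N ((cayley \<alpha> F ^^ k) x0 - xs)"
proof -
  show s: "N ((cayley \<alpha> F ^^ Suc k) x0 - xs) \<le> q * N ((cayley \<alpha> F ^^ k) x0 - xs)" for k
    using assms(3) by simp
  show "(\<lambda>k. N ((cayley \<alpha> F ^^ k) x0 - xs)) \<longlonglongrightarrow> 0"
    by (rule contraction_factor_limit[where q=q]) (use s assms(4) in auto)
qed

end

text \<open>The difference of the two sides vanishes at \<open>\<alpha> = 0\<close> with derivative
  \<open>- 2 * c\<close>, the contributions of \<open>l\<close> cancelling.\<close>

lemma exp_factor_small:
  fixes c l :: real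
  assumes "c > 0"
  shows "\<exists>\<alpha>0>0. \<forall>\<alpha>. 0 < \<alpha> \<and> \<alpha> \<le> \<alpha>0 \<longrightarrow> exp (- \<alpha> * c) + exp (\<alpha> * l) - 1 - \<alpha> * l < 1 + \<alpha> * c"
proof -
  define \<phi> where "\<phi> = (\<lambda>\<alpha>. exp (- \<alpha> * c) + exp (\<alpha> * l) - 1 - \<alpha> * l - (1 + \<alpha> * c))"
  have "(\<phi> has_real_derivative - 2 * c) (at 0)"
    unfolding \<phi>_def by (auto intro!: derivative_eq_intros)
  then obtain d where d: "d > 0" "\<And>h. h > 0 \<Longrightarrow> h < d \<Longrightarrow> \<phi> (0 + h) < \<phi> 0"
    using DERIV_neg_dec_right[of \<phi> "- 2 * c" 0] assms by auto
  show ?thesis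
  proof (intro exI[of _ "d / 2"] conjI allI impI)
    fix \<alpha> assume "0 < \<alpha> \<and> \<alpha> \<le> d / 2"
    then have "\<phi> \<alpha> < 0" using d(2)[of \<alpha>] by (auto simp: \<phi>_def)
    then show "exp (- \<alpha> * c) + exp (\<alpha> * l) - 1 - \<alpha> * l < 1 + \<alpha> * c"
      by (simp add: \<phi>_def)
  qed (use d in simp)
qed

section \<open>Diagonally weighted norms\<close>

text \<open>Removes the perturbations by \<open>\<epsilon>\<close> that make a maximum strict or
  signs definite.\<close>

lemma continuous_nonneg_at_0:
  fixes \<psi> :: "real \<Rightarrow> real"
  assumes "continuous_on UNIV \<psi>" and "\<And>\<epsilon>. \<epsilon> > 0 \<Longrightarrow> \<psi> \<epsilon> \<ge> 0"
  shows "\<psi> 0 \<ge> 0"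
proof (rule tendsto_lowerbound)
  show "(\<psi> \<longlongrightarrow> \<psi> 0) (at_right 0)"
    using assms(1) by (simp add: continuous_on_def filterlim_at_split)
  show "\<forall>\<^sub>F \<epsilon> in at_right 0. 0 \<le> \<psi> \<epsilon>"
    using assms(2) by (auto simp: eventually_at_right_less intro: eventually_mono[OF eventually_at_right_less])
qed simp

section \<open>The weighted maximum norm\<close>

lemma wnorminf_le_iff:
  assumes "\<And>i. \<eta> i > 0"
  shows "wnorminf \<eta> x \<le> r \<longleftrightarrow> (\<forall>i. \<bar>x $ i\<bar> \<le> r * \<eta> i)"
  using assms by (simp add: wnorminf_def pos_divide_le_eq)

lemma wnorminf_component: "\<bar>x $ i\<bar> / \<eta> i \<le> wnorminf \<eta> x"
  unfolding wnorminf_def by (rule Max_ge) auto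

lemma wnorminf_attained: obtains i where "wnorminf \<eta> x = \<bar>x $ i\<bar> / \<eta> i"
proof -
  have "wnorminf \<eta> x \<in> (\<lambda>i. \<bar>x $ i\<bar> / \<eta> i) ` UNIV" unfolding wnorminf_def by (rule Max_in) auto
  then show ?thesis using that by auto
qed

context monotone_map begin

text \<open>A coordinate that alone attains the norm still does so after a small perturbation, and
  expansivity becomes an inequality for that coordinate. Raising \<open>u $ i\<close> by
  \<open>\<epsilon>\<close> makes it the only one; continuity removes
  \<open>\<epsilon>\<close>.\<close>

lemma wnorminf_dominant_component:
  assumes \<eta>: "\<And>i. \<eta> i > 0" and N: "N = wnorminf \<eta>"
    and dom: "\<And>j. \<bar>u $ j\<bar> / \<eta> j \<le> u $ i / \<eta> i"
  shows "c * u $ i \<le> F (x + u) $ i - F x $ i"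
proof -
  have ui: "u $ i \<ge> 0"
    using dom[of i] \<eta>[of i] by (simp add: divide_le_cancel)
  have "c * (u $ i + \<epsilon>) \<le> F (x + u + \<epsilon> *\<^sub>R axis i 1) $ i - F x $ i" if \<epsilon>: "\<epsilon> > 0" for \<epsilon>
  proof -
    define v where "v = u + \<epsilon> *\<^sub>R axis i 1"
    define \<Delta> where "\<Delta> = F (x + v) - F x"
    define r where "r = u $ i / \<eta> i"
    have vi: "v $ i = u $ i + \<epsilon>" by (simp add: v_def)
    have vj: "\<bar>v $ j\<bar> / \<eta> j \<le> r" if "j \<noteq> i" for j using dom[of j] that by (simp add: v_def r_def axis_def)
    \<comment> \<open>Keeps \<open>a * N \<Delta>\<close> below
      \<open>\<epsilon> / \<eta> i\<close>, the lead of coordinate \<open>i\<close> over the others;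
      the added 1 keeps the denominator positive.\<close>
    define a where "a = \<epsilon> / \<eta> i / (2 * (N \<Delta> + 1))"
    have N1: "N \<Delta> + 1 > 0" by (simp add: add_nonneg_pos)
    have a: "a > 0" using \<epsilon> \<eta>[of i] N1 by (simp add: a_def)
    have "a * N \<Delta> < a * (2 * (N \<Delta> + 1))" using a N1 by (intro mult_strict_left_mono) auto
    then have aN: "a * N \<Delta> < \<epsilon> / \<eta> i" using N1 by (simp add: a_def)
    have \<Delta>j: "\<bar>\<Delta> $ j\<bar> / \<eta> j \<le> N \<Delta>" for j unfolding N by (rule wnorminf_component)
    have ex: "(1 + a * c) * N v \<le> N (v + a *\<^sub>R \<Delta>)"
      using expansive[of a "x + v" x] a by (simp add: \<Delta>_def)
    have Nv: "(u $ i + \<epsilon>) / \<eta> i \<le> N v"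
      using wnorminf_component[of v i \<eta>] ui \<epsilon> by (simp add: N vi)
    have "(u $ i + \<epsilon>) / \<eta> i \<le> (1 + a * c) * N v"
    proof -
      have "1 * N v \<le> (1 + a * c) * N v" using a c_nonneg by (intro mult_right_mono) auto
      then show ?thesis using Nv by simp
    qed
    then have big: "r + \<epsilon> / \<eta> i \<le> N (v + a *\<^sub>R \<Delta>)" using ex by (simp add: r_def add_divide_distrib)
    obtain j where j: "N (v + a *\<^sub>R \<Delta>) = \<bar>(v + a *\<^sub>R \<Delta>) $ j\<bar> / \<eta> j"
      unfolding N by (rule wnorminf_attained)
    have "j = i"
    proof (rule ccontr)
      assume "j \<noteq> i"
      have "\<bar>(v + a *\<^sub>R \<Delta>) $ j\<bar> / \<eta> j \<le> (\<bar>v $ j\<bar> + a * \<bar>\<Delta> $ j\<bar>) / \<eta> j"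
        using \<eta>[of j] a abs_triangle_ineq[of "v $ j" "a * \<Delta> $ j"]
        by (intro divide_right_mono) (auto simp: abs_mult)
      also have "\<dots> = \<bar>v $ j\<bar> / \<eta> j + a * (\<bar>\<Delta> $ j\<bar> / \<eta> j)" by (simp add: add_divide_distrib)
      also have "\<dots> \<le> r + a * N \<Delta>" using vj[OF \<open>j \<noteq> i\<close>] \<Delta>j[of j] a by (intro add_mono mult_left_mono) auto
      finally show False using big j aN by simp
    qed
    have "a * \<bar>\<Delta> $ i\<bar> < \<epsilon>"
    proof -
      have "a * (\<bar>\<Delta> $ i\<bar> / \<eta> i) \<le> a * N \<Delta>" using \<Delta>j[of i] a by (intro mult_left_mono) auto
      then have "a * \<bar>\<Delta> $ i\<bar> / \<eta> i < \<epsilon> / \<eta> i" using aN by simp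
      then show ?thesis using \<eta>[of i] by (simp add: divide_less_cancel)
    qed
    then have "\<bar>a * \<Delta> $ i\<bar> < \<epsilon>" using a by (simp add: abs_mult)
    then have "\<bar>(v + a *\<^sub>R \<Delta>) $ i\<bar> = u $ i + \<epsilon> + a * \<Delta> $ i" using ui by (simp add: vi)
    moreover have "(1 + a * c) * ((u $ i + \<epsilon>) / \<eta> i) \<le> (1 + a * c) * N v"
      using Nv a c_nonneg by (intro mult_left_mono) auto
    ultimately have "(1 + a * c) * (u $ i + \<epsilon>) / \<eta> i \<le> (u $ i + \<epsilon> + a * \<Delta> $ i) / \<eta> i"
      using ex j \<open>j = i\<close> by simp
    then have "(1 + a * c) * (u $ i + \<epsilon>) \<le> u $ i + \<epsilon> + a * \<Delta> $ i"
      using \<eta>[of i] by (simp add: divide_le_cancel)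
    then have "a * (c * (u $ i + \<epsilon>)) \<le> a * \<Delta> $ i" by (simp add: algebra_simps)
    then have "c * (u $ i + \<epsilon>) \<le> \<Delta> $ i" using a by simp
    then show ?thesis by (simp add: \<Delta>_def v_def add.assoc)
  qed
  then have nonneg: "0 \<le> F (x + u + \<epsilon> *\<^sub>R axis i 1) $ i - F x $ i - c * (u $ i + \<epsilon>)" if "\<epsilon> > 0" for \<epsilon>
    using that by simp
  have "continuous_on UNIV (\<lambda>\<epsilon>. F (x + u + \<epsilon> *\<^sub>R axis i 1) $ i - F x $ i - c * (u $ i + \<epsilon>))"
    by (intro continuous_intros continuous_on_compose2[OF F_continuous[of UNIV]]) auto
  from continuous_nonneg_at_0[OF this nonneg] show ?thesis by simp
qed

text \<open>Raising \<open>u $ i\<close> to its largest value \<open>N u * \<eta> i\<close> makes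
  coordinate \<open>i\<close> dominant, which bounds component \<open>i\<close> of the increment of
  \<open>F\<close> from below. Lowering it back costs at most \<open>d * s\<close>, and
  \<open>\<alpha> * d \<le> 1\<close> lets the identity part absorb this.\<close>

lemma forward_step_wnorminf:
  assumes \<eta>: "\<And>i. \<eta> i > 0" and N: "N = wnorminf \<eta>"
    and d: "\<And>x i t. t \<ge> 0 \<Longrightarrow> F (x + t *\<^sub>R axis i 1) $ i - F x $ i \<le> d * t"
    and \<alpha>: "\<alpha> > 0" "\<alpha> * d \<le> 1"
  shows "N (u - \<alpha> *\<^sub>R (F (x + u) - F x)) \<le> (1 - \<alpha> * c) * N u"
proof -
  have upper: "u $ i - \<alpha> * (F (x + u) $ i - F x $ i) \<le> (1 - \<alpha> * c) * (N u * \<eta> i)" for u x i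
  proof -
    define r where "r = N u"
    define s where "s = r * \<eta> i - u $ i"
    have ur: "\<bar>u $ j\<bar> / \<eta> j \<le> r" for j unfolding r_def N by (rule wnorminf_component)
    have s: "s \<ge> 0" using ur[of i] \<eta>[of i] by (auto simp: s_def pos_divide_le_eq)
    have r0: "r \<ge> 0" by (simp add: r_def)
    define v where "v = u + s *\<^sub>R axis i 1"
    have vi: "v $ i = r * \<eta> i" by (simp add: v_def s_def)
    have "\<bar>v $ j\<bar> / \<eta> j \<le> v $ i / \<eta> i" for j
    proof (cases "j = i")
      case True then show ?thesis using r0 \<eta>[of i] by (simp add: vi abs_mult)
    next
      case False then show ?thesis using ur[of j] \<eta>[of i] unfolding vi by (simp add: v_def axis_def)
    qed
    from wnorminf_dominant_component[OF \<eta> N this, of x]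
    have 1: "c * (r * \<eta> i) \<le> F (x + v) $ i - F x $ i" by (simp add: vi)
    have 2: "F (x + v) $ i - F (x + u) $ i \<le> d * s"
      using d[OF s, of "x + u" i] by (simp add: v_def add.assoc)
    have "c * (r * \<eta> i) - d * s \<le> F (x + u) $ i - F x $ i" using 1 2 by simp
    then have "\<alpha> * (c * (r * \<eta> i) - d * s) \<le> \<alpha> * (F (x + u) $ i - F x $ i)"
      using \<alpha> by (intro mult_left_mono) auto
    moreover have "(\<alpha> * d) * s \<le> 1 * s" using \<alpha> s by (intro mult_right_mono)
    ultimately show ?thesis by (simp add: r_def[symmetric] s_def algebra_simps)
  qed
  \<comment> \<open>The lower bound is the upper one for the reversed displacement
    \<open>- u\<close> starting at \<open>x + u\<close>.\<close>
  have "\<bar>(u - \<alpha> *\<^sub>R (F (x + u) - F x)) $ i\<bar> \<le> ((1 - \<alpha> * c) * N u) * \<eta> i" for i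
    using upper[of u i x] upper[of "- u" i "x + u"]
    by (auto simp: abs_le_iff algebra_simps)
  then show ?thesis using wnorminf_le_iff[of \<eta>, OF \<eta>] unfolding N by blast
qed

text \<open>With all coordinates away from 0 the norm is linear nearby, with signs \<open>s\<close>,
  so expansivity for a small step gives the inequality. Shifting coordinate \<open>i\<close> by
  \<open>\<epsilon> * s i\<close> achieves this; where \<open>u $ i = 0\<close> the sign remains
  free.\<close>

lemma wnorm1_sign_inequality:
  assumes \<eta>: "\<And>i. \<eta> i > 0" and N: "N = wnorm1 \<eta>"
    and s: "\<And>i. \<bar>s i\<bar> = 1" "\<And>i. s i * u $ i = \<bar>u $ i\<bar>"
  shows "c * N u \<le> (\<Sum>i\<in>UNIV. \<eta> i * (s i * (F (x + u) $ i - F x $ i)))"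
proof -
  define w where "w = (\<chi> i. s i)"
  have ss: "s i * s i = 1" for i using s(1)[of i] by (auto simp: abs_if split: if_splits)
  have "c * N (u + \<epsilon> *\<^sub>R w) \<le> (\<Sum>i\<in>UNIV. \<eta> i * (s i * (F (x + (u + \<epsilon> *\<^sub>R w)) $ i - F x $ i)))" if \<epsilon>: "\<epsilon> > 0" for \<epsilon>
  proof -
    define v where "v = u + \<epsilon> *\<^sub>R w"
    define \<Delta> where "\<Delta> = F (x + v) - F x"
    have sv: "s i * v $ i = \<bar>u $ i\<bar> + \<epsilon>" for i
    proof -
      have "s i * v $ i = s i * u $ i + \<epsilon> * (s i * s i)" by (simp add: v_def w_def algebra_simps)
      then show ?thesis using s(2)[of i] ss[of i] by simp
    qed
    have absv: "\<bar>v $ i\<bar> = s i * v $ i" for i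
    proof -
      have "\<bar>v $ i\<bar> = \<bar>s i * v $ i\<bar>" using s(1)[of i] by (simp add: abs_mult)
      then show ?thesis using sv[of i] \<epsilon> by simp
    qed
    \<comment> \<open>Short enough that no coordinate of \<open>v + a \<Delta>\<close> crosses 0,
      those of \<open>v\<close> having modulus at least \<open>\<epsilon>\<close>.\<close>
    define a where "a = \<epsilon> / (norm \<Delta> + 1)"
    have n1: "norm \<Delta> + 1 > 0" by (simp add: add_nonneg_pos)
    have a: "a > 0" using \<epsilon> n1 by (simp add: a_def)
    have "a * norm \<Delta> \<le> a * (norm \<Delta> + 1)" using a by (intro mult_left_mono) auto
    then have aN: "a * norm \<Delta> \<le> \<epsilon>" using n1 by (simp add: a_def)
    have abs2: "\<bar>(v + a *\<^sub>R \<Delta>) $ i\<bar> = s i * v $ i + a * (s i * \<Delta> $ i)" for i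
    proof -
      have "\<bar>(v + a *\<^sub>R \<Delta>) $ i\<bar> = \<bar>s i * (v + a *\<^sub>R \<Delta>) $ i\<bar>"
        using s(1)[of i] by (simp add: abs_mult del: vector_add_component)
      also have "s i * (v + a *\<^sub>R \<Delta>) $ i = s i * v $ i + a * (s i * \<Delta> $ i)" by (simp add: algebra_simps)
      finally have 1: "\<bar>(v + a *\<^sub>R \<Delta>) $ i\<bar> = \<bar>s i * v $ i + a * (s i * \<Delta> $ i)\<bar>" .
      have "\<bar>a * (s i * \<Delta> $ i)\<bar> = a * \<bar>\<Delta> $ i\<bar>" using s(1)[of i] a by (simp add: abs_mult)
      also have "\<dots> \<le> a * norm \<Delta>" using a by (intro mult_left_mono component_le_norm_cart) auto
      finally have "\<bar>a * (s i * \<Delta> $ i)\<bar> \<le> \<epsilon>" using aN by simp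
      then show ?thesis using 1 sv[of i] by simp
    qed
    have Nv: "N v = (\<Sum>i\<in>UNIV. \<eta> i * (s i * v $ i))" by (simp add: N wnorm1_def absv)
    have "(1 + a * c) * N v \<le> N (v + a *\<^sub>R \<Delta>)"
      using expansive[of a "x + v" x] a by (simp add: \<Delta>_def)
    also have "N (v + a *\<^sub>R \<Delta>) = N v + a * (\<Sum>i\<in>UNIV. \<eta> i * (s i * \<Delta> $ i))"
      unfolding Nv unfolding N wnorm1_def abs2
      by (simp add: distrib_left sum.distrib sum_distrib_left mult_ac)
    finally have "a * (c * N v) \<le> a * (\<Sum>i\<in>UNIV. \<eta> i * (s i * \<Delta> $ i))" by (simp add: algebra_simps)
    then have "c * N v \<le> (\<Sum>i\<in>UNIV. \<eta> i * (s i * \<Delta> $ i))" using a by simp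
    then show ?thesis by (simp add: \<Delta>_def v_def)
  qed
  then have nonneg: "0 \<le> (\<Sum>i\<in>UNIV. \<eta> i * (s i * (F (x + (u + \<epsilon> *\<^sub>R w)) $ i - F x $ i))) - c * N (u + \<epsilon> *\<^sub>R w)"
    if "\<epsilon> > 0" for \<epsilon>
    using that by simp
  have "continuous_on UNIV (\<lambda>\<epsilon>. (\<Sum>i\<in>UNIV. \<eta> i * (s i * (F (x + (u + \<epsilon> *\<^sub>R w)) $ i - F x $ i)))
      - c * N (u + \<epsilon> *\<^sub>R w))"
    by (intro continuous_intros continuous_on_compose2[OF F_continuous[of UNIV]]
        continuous_on_compose2[OF N_continuous[of UNIV]]) auto
  from continuous_nonneg_at_0[OF this nonneg] show ?thesis by simp
qed

lemma wnorm1_axis: "wnorm1 \<eta> (t *\<^sub>R axis j 1) = \<eta> j * \<bar>t\<bar>"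
proof -
  have "wnorm1 \<eta> (t *\<^sub>R axis j 1) = (\<Sum>i\<in>UNIV. if i = j then \<eta> j * \<bar>t\<bar> else 0)"
    unfolding wnorm1_def by (intro sum.cong) (auto simp: axis_def)
  then show ?thesis by simp
qed

text \<open>On a coordinate axis the signs of the other components are free and are chosen against
  those of \<open>\<Delta>\<close>. The sign inequality then says that component \<open>j\<close>
  outweighs the others, and the norm of the forward step can be computed exactly.\<close>

lemma forward_step_wnorm1_axis:
  assumes \<eta>: "\<And>i. \<eta> i > 0" and N: "N = wnorm1 \<eta>"
    and d: "\<And>x i t. t \<ge> 0 \<Longrightarrow> F (x + t *\<^sub>R axis i 1) $ i - F x $ i \<le> d * t"
    and \<alpha>: "\<alpha> > 0" "\<alpha> * d \<le> 1"
  shows "N (t *\<^sub>R axis j 1 - \<alpha> *\<^sub>R (F (x + t *\<^sub>R axis j 1) - F x)) \<le> (1 - \<alpha> * c) * (\<eta> j * \<bar>t\<bar>)"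
proof -
  have pos: "N (t *\<^sub>R axis j 1 - \<alpha> *\<^sub>R (F (x + t *\<^sub>R axis j 1) - F x)) \<le> (1 - \<alpha> * c) * (\<eta> j * t)"
    if t: "t \<ge> 0" for t x
  proof -
    define u :: "real^'n" where "u = t *\<^sub>R axis j 1"
    define \<Delta> where "\<Delta> = F (x + u) - F x"
    define s where "s = (\<lambda>i. if i = j then 1 else if \<Delta> $ i > 0 then -1 else 1 :: real)"
    have "c * N u \<le> (\<Sum>i\<in>UNIV. \<eta> i * (s i * (F (x + u) $ i - F x $ i)))"
      by (rule wnorm1_sign_inequality[OF \<eta> N]) (use t in \<open>auto simp: s_def u_def axis_def\<close>)
    then have key: "c * (\<eta> j * t) \<le> (\<Sum>i\<in>UNIV. \<eta> i * (s i * \<Delta> $ i))"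
      using t by (simp add: \<Delta>_def u_def N wnorm1_axis)
    \<comment> \<open>The bound by \<open>d\<close> enters here: component \<open>j\<close> of the
      forward step stays nonnegative, so its modulus is
      \<open>t - \<alpha> * \<Delta> $ j\<close>.\<close>
    have dj: "\<alpha> * \<Delta> $ j \<le> t"
    proof -
      have "\<alpha> * \<Delta> $ j \<le> \<alpha> * (d * t)" using d[OF t, of x j] \<alpha> by (simp add: \<Delta>_def u_def)
      also have "\<dots> \<le> 1 * t" using mult_right_mono[OF \<alpha>(2) t] by (simp add: mult_ac)
      finally show ?thesis by simp
    qed
    have "\<bar>(u - \<alpha> *\<^sub>R \<Delta>) $ i\<bar> = (if i = j then t else 0) - \<alpha> * (s i * \<Delta> $ i)" for i
      using dj \<alpha>(1) by (auto simp: u_def s_def axis_def abs_mult abs_if zero_less_mult_iff)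
    then have "N (u - \<alpha> *\<^sub>R \<Delta>) = (\<Sum>i\<in>UNIV. \<eta> i * ((if i = j then t else 0) - \<alpha> * (s i * \<Delta> $ i)))"
      by (simp add: N wnorm1_def)
    also have "\<dots> = (\<Sum>i\<in>UNIV. if i = j then \<eta> j * t else 0) - \<alpha> * (\<Sum>i\<in>UNIV. \<eta> i * (s i * \<Delta> $ i))"
      unfolding sum_distrib_left sum_subtractf[symmetric]
      by (intro sum.cong) (auto simp: algebra_simps)
    also have "\<dots> \<le> \<eta> j * t - \<alpha> * (c * (\<eta> j * t))"
      using mult_left_mono[OF key, of \<alpha>] \<alpha> by simp
    finally show ?thesis by (simp add: u_def \<Delta>_def algebra_simps)
  qed
  show ?thesis
  proof (cases "t \<ge> 0")
    case True
    then show ?thesis using pos[of t x] by simp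
  next
    case False
    \<comment> \<open>A negative step is a positive one from the other end point; the vector only
      changes sign.\<close>
    then have "N ((- t) *\<^sub>R axis j 1 - \<alpha> *\<^sub>R (F ((x + t *\<^sub>R axis j 1) + (- t) *\<^sub>R axis j 1) - F (x + t *\<^sub>R axis j 1)))
       \<le> (1 - \<alpha> * c) * (\<eta> j * (- t))"
      by (intro pos) simp
    moreover have "(- t) *\<^sub>R axis j 1 - \<alpha> *\<^sub>R (F ((x + t *\<^sub>R axis j 1) + (- t) *\<^sub>R axis j 1) - F (x + t *\<^sub>R axis j 1))
       = - (t *\<^sub>R axis j 1 - \<alpha> *\<^sub>R (F (x + t *\<^sub>R axis j 1) - F x))"
      by (simp add: algebra_simps)
    ultimately show ?thesis using False by (simp only: N_minus abs_of_neg not_le)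
  qed
qed

text \<open>The weighted l1 norm is additive along the coordinate steps leading from x to x + u.\<close>

lemma forward_step_wnorm1:
  assumes \<eta>: "\<And>i. \<eta> i > 0" and N: "N = wnorm1 \<eta>"
    and d: "\<And>x i t. t \<ge> 0 \<Longrightarrow> F (x + t *\<^sub>R axis i 1) $ i - F x $ i \<le> d * t"
    and \<alpha>: "\<alpha> > 0" "\<alpha> * d \<le> 1"
  shows "N (u - \<alpha> *\<^sub>R (F (x + u) - F x)) \<le> (1 - \<alpha> * c) * N u"
proof -
  have part: "N ((\<Sum>i\<in>S. u $ i *\<^sub>R axis i 1) - \<alpha> *\<^sub>R (F (x + (\<Sum>i\<in>S. u $ i *\<^sub>R axis i 1)) - F x))
      \<le> (1 - \<alpha> * c) * (\<Sum>i\<in>S. \<eta> i * \<bar>u $ i\<bar>)" if "finite S" for S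
    using that
  proof induction
    case (insert j S)
    define w where "w = (\<Sum>i\<in>S. u $ i *\<^sub>R axis i 1 :: real^'n)"
    define v :: "real^'n" where "v = u $ j *\<^sub>R axis j 1"
    have "(v + w) - \<alpha> *\<^sub>R (F (x + (v + w)) - F x)
        = (w - \<alpha> *\<^sub>R (F (x + w) - F x)) + (v - \<alpha> *\<^sub>R (F ((x + w) + v) - F (x + w)))"
      by (simp add: algebra_simps)
    then have "N ((v + w) - \<alpha> *\<^sub>R (F (x + (v + w)) - F x))
        \<le> N (w - \<alpha> *\<^sub>R (F (x + w) - F x)) + N (v - \<alpha> *\<^sub>R (F ((x + w) + v) - F (x + w)))"
      by (metis N_triangle)
    also have "\<dots> \<le> (1 - \<alpha> * c) * (\<Sum>i\<in>S. \<eta> i * \<bar>u $ i\<bar>) + (1 - \<alpha> * c) * (\<eta> j * \<bar>u $ j\<bar>)"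
      using insert.IH unfolding w_def[symmetric] v_def
      by (intro add_mono forward_step_wnorm1_axis[OF \<eta> N d \<alpha>]) 
    finally show ?case
      using insert.hyps unfolding w_def v_def by (simp add: algebra_simps)
  qed simp
  have u: "(\<Sum>i\<in>UNIV. u $ i *\<^sub>R axis i 1) = u"
    using basis_expansion[of u] by (simp add: scalar_mult_eq_scaleR)
  have "(\<Sum>i\<in>UNIV. \<eta> i * \<bar>u $ i\<bar>) = N u" by (simp add: N wnorm1_def)
  then show ?thesis using part[OF finite_class.finite_UNIV] unfolding u by simp
qed

lemma forward_step_diag_weighted:
  assumes "diag_weighted_l1_or_linf N"
    and "\<And>x i t. t \<ge> 0 \<Longrightarrow> F (x + t *\<^sub>R axis i 1) $ i - F x $ i \<le> d * t"
    and "\<alpha> > 0" "\<alpha> * d \<le> 1"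
  shows "N (x - \<alpha> *\<^sub>R F x - (y - \<alpha> *\<^sub>R F y)) \<le> (1 - \<alpha> * c) * N (x - y)"
proof -
  obtain \<eta> where \<eta>: "\<And>i. \<eta> i > 0" "N = wnorm1 \<eta> \<or> N = wnorminf \<eta>"
    using assms(1) by (auto simp: diag_weighted_l1_or_linf_def)
  have "N ((x - y) - \<alpha> *\<^sub>R (F (y + (x - y)) - F y)) \<le> (1 - \<alpha> * c) * N (x - y)"
    using \<eta>(2)
  proof
    assume N: "N = wnorm1 \<eta>"
    show ?thesis by (rule forward_step_wnorm1[OF \<eta>(1) N assms(2-4)])
  next
    assume N: "N = wnorminf \<eta>"
    show ?thesis by (rule forward_step_wnorminf[OF \<eta>(1) N assms(2-4)])
  qed
  then show ?thesis by (simp add: algebra_simps)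
qed

end

section \<open>Averaged maps\<close>

context norm_function begin

text \<open>The Goebel-Kirk inequality for constant displacement. By convexity, the distance from
  \<open>S (z (i + n + 1))\<close> to \<open>z (i + 1)\<close> is split between \<open>z i\<close>
  and \<open>S (z i)\<close>; the latter part is at most the path length of the orbit, so the former
  has to be large.\<close>

lemma averaged_orbit_drift:
  assumes S: "\<And>x y. N (S x - S y) \<le> N (x - y)" and t: "0 < t" "t < 1"
    and z: "\<And>i. z (Suc i) = (1 - t) *\<^sub>R z i + t *\<^sub>R S (z i)"
    and \<rho>: "\<And>i. N (S (z i) - z i) = \<rho>"
  shows "(1 + real n * t) * \<rho> \<le> N (S (z (i + n)) - z i)"
proof (induction n arbitrary: i)
  case (Suc n)
  have step: "N (z (Suc k) - z k) = t * \<rho>" for k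
  proof -
    have "z (Suc k) - z k = t *\<^sub>R (S (z k) - z k)" by (simp add: z algebra_simps)
    then show ?thesis using t \<rho>[of k] by (simp add: N_scale)
  qed
  have dist: "N (z (i + m) - z i) \<le> real m * t * \<rho>" for m
  proof (induction m)
    case (Suc m)
    then show ?case
      using N_triangle_diff[of "z (i + Suc m)" "z i" "z (i + m)"] step[of "i + m"] by (simp add: algebra_simps)
  qed simp
  define Y where "Y = S (z (i + Suc n))"
  have "(1 + real n * t) * \<rho> \<le> N (Y - z (Suc i))" using Suc.IH[of "Suc i"] by (simp add: Y_def)
  also have "Y - z (Suc i) = (1 - t) *\<^sub>R (Y - z i) + t *\<^sub>R (Y - S (z i))"
    by (simp add: z algebra_simps)
  also have "N \<dots> \<le> (1 - t) * N (Y - z i) + t * N (Y - S (z i))"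
    using N_triangle[of "(1 - t) *\<^sub>R (Y - z i)" "t *\<^sub>R (Y - S (z i))"] t by (simp add: N_scale)
  also have "t * N (Y - S (z i)) \<le> t * (real (Suc n) * t * \<rho>)"
    using order_trans[OF S dist[of "Suc n"]] t unfolding Y_def by (intro mult_left_mono) auto
  finally have "(1 + real n * t) * \<rho> - t * (real (Suc n) * t * \<rho>) \<le> (1 - t) * N (Y - z i)" by simp
  \<comment> \<open>The factor \<open>1 - t\<close> splits off exactly, which turns \<open>n\<close>
    into \<open>Suc n\<close>.\<close>
  moreover have "(1 + real n * t) * \<rho> - t * (real (Suc n) * t * \<rho>) = (1 - t) * ((1 + real (Suc n) * t) * \<rho>)"
    by (simp add: algebra_simps)
  ultimately have "(1 - t) * ((1 + real (Suc n) * t) * \<rho>) \<le> (1 - t) * N (Y - z i)" by simp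
  then show ?case using t by (simp add: Y_def)
qed (simp add: \<rho>)

text \<open>Boundedness around \<open>p\<close> gives a cluster point \<open>q\<close>.
  Displacements decrease to a limit, hence are constant along the orbit of \<open>q\<close>; a
  positive constant would make that orbit drift off linearly, against boundedness. So
  \<open>q\<close> is fixed, and the decreasing distances to it tend to 0.\<close>

theorem averaged_iteration_converges:
  assumes S: "\<And>x y. N (S x - S y) \<le> N (x - y)" and t: "0 < t" "t < 1"
    and T: "\<And>x. T x = (1 - t) *\<^sub>R x + t *\<^sub>R S x" and p: "T p = p"
  shows "\<exists>q. T q = q \<and> (\<lambda>k. N ((T ^^ k) x - q)) \<longlonglongrightarrow> 0"
proof -
  have disp: "T x - x = t *\<^sub>R (S x - x)" for x by (simp add: T algebra_simps)
  have fixed_iff: "T x = x \<longleftrightarrow> S x = x" for x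
    using disp[of x] t by (metis eq_iff_diff_eq_0 scaleR_eq_0_iff less_irrefl)
  have Tn: "N (T x - T y) \<le> N (x - y)" for x y
  proof -
    have "T x - T y = (1 - t) *\<^sub>R (x - y) + t *\<^sub>R (S x - S y)" by (simp add: T algebra_simps)
    then have "N (T x - T y) \<le> (1 - t) * N (x - y) + t * N (S x - S y)"
      using N_triangle[of "(1 - t) *\<^sub>R (x - y)" "t *\<^sub>R (S x - S y)"] t by (simp add: N_scale)
    also have "t * N (S x - S y) \<le> t * N (x - y)" using S t by (intro mult_left_mono) auto
    finally show ?thesis by (simp add: algebra_simps)
  qed
  have Tc: "continuous_on UNIV T"
    using lipschitz_wrt_imp_lipschitz_on[of 1 T] Tn lipschitz_on_continuous_on
    by (auto simp: lipschitz_wrt_def)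
  have Tkc: "continuous_on UNIV (T ^^ j)" for j
  proof (induction j)
    case (Suc j)
    then show ?case using continuous_on_compose[OF Suc, of T] Tc continuous_on_subset
      by (simp add: o_def) blast
  qed (simp add: id_def)
  define X where "X = (\<lambda>k. (T ^^ k) x)"
  have XS: "X (Suc k) = T (X k)" for k by (simp add: X_def)
  have Xj: "X (k + j) = (T ^^ j) (X k)" for k j by (induction j) (simp_all add: XS)
  have bounded_orbit: "N ((T ^^ k) y - p) \<le> N (y - p)" for k y
  proof (induction k)
    case (Suc k)
    then show ?case using Tn[of "(T ^^ k) y" p] p by simp
  qed simp
  obtain K where K: "K > 0" "\<And>x. norm x \<le> K * N x" using N_lower by blast
  have "norm (X k - p) \<le> K * N (x - p)" for k
    unfolding X_def by (rule order_trans[OF K(2) mult_left_mono[OF bounded_orbit less_imp_le[OF K(1)]]])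
  then have "\<forall>k. X k \<in> cball p (K * N (x - p))" by (simp add: dist_norm norm_minus_commute)
  then obtain q r where r: "strict_mono r" "(X \<circ> r) \<longlonglongrightarrow> q"
    using compact_cball[of p "K * N (x - p)"] unfolding compact_def by blast
  have antimono: "\<exists>L. f \<longlonglongrightarrow> L" if "\<And>k. f (Suc k) \<le> f k" "\<And>k. f k \<ge> 0" for f :: "nat \<Rightarrow> real"
    using decseq_convergent[of f 0] that by (metis decseq_SucI)
  have "\<exists>L. (\<lambda>k. N (X (Suc k) - X k)) \<longlonglongrightarrow> L"
    by (rule antimono) (auto simp: XS intro: Tn)
  then obtain \<delta> where \<delta>: "(\<lambda>k. N (X (Suc k) - X k)) \<longlonglongrightarrow> \<delta>" by blast
  \<comment> \<open>Along the indices \<open>r k + j\<close> the displacement tends to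
    \<open>\<delta>\<close> and, by continuity, to that of \<open>(T ^^ j) q\<close>.\<close>
  have const: "N (T ((T ^^ j) q) - (T ^^ j) q) = \<delta>" for j
  proof -
    have 1: "(\<lambda>k. (T ^^ i) (X (r k))) \<longlonglongrightarrow> (T ^^ i) q" for i
      using continuous_on_tendsto_compose[OF Tkc r(2)] by (simp add: o_def)
    have "(\<lambda>k. (T ^^ Suc j) (X (r k)) - (T ^^ j) (X (r k))) \<longlonglongrightarrow> (T ^^ Suc j) q - (T ^^ j) q"
      by (intro tendsto_diff 1)
    from continuous_on_tendsto_compose[OF N_continuous[of UNIV] this]
    have "(\<lambda>k. N ((T ^^ Suc j) (X (r k)) - (T ^^ j) (X (r k)))) \<longlonglongrightarrow> N ((T ^^ Suc j) q - (T ^^ j) q)"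
      by simp
    then have "(\<lambda>k. N (X (Suc (r k + j)) - X (r k + j))) \<longlonglongrightarrow> N ((T ^^ Suc j) q - (T ^^ j) q)"
      unfolding XS Xj by simp
    moreover have "(\<lambda>k. N (X (Suc (r k + j)) - X (r k + j))) \<longlonglongrightarrow> \<delta>"
    proof -
      have "strict_mono (\<lambda>k. r k + j)" using r(1) by (simp add: strict_mono_def)
      from LIMSEQ_subseq_LIMSEQ[OF \<delta> this] show ?thesis by (simp add: o_def)
    qed
    ultimately show ?thesis using LIMSEQ_unique by fastforce
  qed
  \<comment> \<open>A displacement of \<open>T\<close> is \<open>t\<close> times that of
    \<open>S\<close>.\<close>
  define \<rho> where "\<rho> = \<delta> / t"
  define z where "z = (\<lambda>i. (T ^^ i) q)"
  have z: "z (Suc i) = (1 - t) *\<^sub>R z i + t *\<^sub>R S (z i)" for i by (simp add: z_def T)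
  have \<rho>: "N (S (z i) - z i) = \<rho>" for i
  proof -
    have "t * N (S (z i) - z i) = \<delta>" using const[of i] t unfolding disp N_scale z_def by simp
    then show ?thesis using t by (simp add: \<rho>_def field_simps)
  qed
  have "real n * t * \<rho> \<le> 2 * N (q - p)" for n
  proof -
    have "S p = p" using p fixed_iff by simp
    then have "N (S (z n) - p) \<le> N (z n - p)" using S[of "z n" p] by simp
    also have "\<dots> \<le> N (q - p)" unfolding z_def by (rule bounded_orbit)
    finally have "N (S (z n) - z 0) \<le> N (q - p) + N (q - p)"
      using N_triangle_diff[of "S (z n)" "z 0" p] N_minus_commute[of p q] by (simp add: z_def)
    moreover have "(1 + real n * t) * \<rho> \<le> N (S (z n) - z 0)"
      using averaged_orbit_drift[where S=S and z=z and n=n and i=0, OF S t z \<rho>] by simp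
    moreover have "\<rho> \<ge> 0" using \<rho>[of 0] N_nonneg by metis
    ultimately show ?thesis by (simp add: algebra_simps)
  qed
  then have bd: "real n * (t * \<rho>) \<le> 2 * N (q - p)" for n by (simp add: mult.assoc)
  have "\<rho> = 0"
  proof (rule ccontr)
    assume "\<rho> \<noteq> 0"
    moreover have "\<rho> \<ge> 0" using \<rho>[of 0] N_nonneg by metis
    ultimately have "t * \<rho> > 0" using t by simp
    then obtain n :: nat where "2 * N (q - p) < real n * (t * \<rho>)"
      using reals_Archimedean3 by blast
    then show False using bd[of n] by simp
  qed
  then have "S q = q" using \<rho>[of 0] by (simp add: z_def)
  then have q: "T q = q" using fixed_iff by simp
  \<comment> \<open>Distances to a fixed point do not increase, so their limit exists and can be
    read off the subsequence converging to \<open>q\<close>.\<close>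
  have "\<exists>L. (\<lambda>k. N (X k - q)) \<longlonglongrightarrow> L"
    using Tn[of _ q] by (intro antimono) (auto simp: XS q)
  then obtain L where L: "(\<lambda>k. N (X k - q)) \<longlonglongrightarrow> L" by blast
  have "(\<lambda>k. N (X (r k) - q)) \<longlonglongrightarrow> L"
    using LIMSEQ_subseq_LIMSEQ[OF L r(1)] by (simp add: o_def)
  moreover have "(\<lambda>k. N (X (r k) - q)) \<longlonglongrightarrow> 0"
  proof -
    have "(\<lambda>k. X (r k) - q) \<longlonglongrightarrow> q - q" using r(2) by (intro tendsto_diff tendsto_const) (simp add: o_def)
    from continuous_on_tendsto_compose[OF N_continuous[of UNIV] this] show ?thesis by simp
  qed
  ultimately have "L = 0" by (rule LIMSEQ_unique)
  then show ?thesis using L q by (auto simp: X_def)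
qed

end

section \<open>The Cayley and proximal point iterations\<close>

lemma lipschitz_derivative_bound:
  fixes F :: "'a::real_normed_vector \<Rightarrow> 'b::real_normed_vector"
  assumes L: "K-lipschitz_on UNIV F" and F': "(F has_derivative F') (at x)"
  shows "norm (F' v) \<le> K * norm v"
proof (cases "v = 0")
  case True
  then show ?thesis using linear_0[OF has_derivative_linear[OF F']] by simp
next
  case False
  have "norm (F' v) / norm v \<le> K + e" if e: "e > 0" for e
  proof -
    obtain d where d: "d > 0" "\<And>y. norm (y - x) < d \<Longrightarrow> norm (F y - F x - F' (y - x)) \<le> e * norm (y - x)"
      using F' e unfolding has_derivative_at_alt by blast
    define t where "t = d / (2 * norm v)"
    have t: "t > 0" using d(1) False by (simp add: t_def)
    have "norm (t *\<^sub>R v) < d" using d(1) False by (simp add: t_def)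
    then have "norm (F (x + t *\<^sub>R v) - F x - F' (t *\<^sub>R v)) \<le> e * norm (t *\<^sub>R v)"
      using d(2)[of "x + t *\<^sub>R v"] by simp
    moreover have "norm (F (x + t *\<^sub>R v) - F x) \<le> K * norm (t *\<^sub>R v)"
      using lipschitz_onD[OF L UNIV_I UNIV_I, of "x + t *\<^sub>R v" x] by (simp add: dist_norm)
    ultimately have "norm (F' (t *\<^sub>R v)) \<le> (K + e) * norm (t *\<^sub>R v)"
      using norm_triangle_ineq2[of "F' (t *\<^sub>R v)" "F (x + t *\<^sub>R v) - F x"]
      by (simp add: norm_minus_commute distrib_right)
    also have "F' (t *\<^sub>R v) = t *\<^sub>R F' v" by (rule linear_scale[OF has_derivative_linear[OF F']])
    finally have "t * norm (F' v) \<le> t * ((K + e) * norm v)" using t by (simp add: mult_ac)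
    then have "norm (F' v) \<le> (K + e) * norm v" using t by simp
    then show ?thesis using False by (simp add: pos_divide_le_eq)
  qed
  then have "norm (F' v) / norm v \<le> K" by (rule field_le_epsilon)
  then show ?thesis using False by (simp add: pos_divide_le_eq)
qed

lemma diagonal_increment_le_diagL:
  fixes F :: "real^'n \<Rightarrow> real^'n"
  assumes L: "K-lipschitz_on UNIV F" and t: "t \<ge> 0"
  shows "F (x + t *\<^sub>R axis i 1) $ i - F x $ i \<le> diagL F * t"
proof -
  \<comment> \<open>Bounding the diagonal entries by the Lipschitz constant makes the
    \<open>Sup\<close> in \<open>diagL\<close> that of a set bounded above, so it dominates each
    entry.\<close>
  have le: "frechet_derivative F (at y) (axis j 1) $ j \<le> K" if "F differentiable (at y)" for y j
  proof -
    have "frechet_derivative F (at y) (axis j 1) $ j \<le> norm (frechet_derivative F (at y) (axis j 1))"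
      using component_le_norm_cart[of "frechet_derivative F (at y) (axis j 1)" j] by linarith
    also have "\<dots> \<le> K * norm (axis j (1::real) :: real^'n)"
      using lipschitz_derivative_bound[OF L] that frechet_derivative_works by blast
    finally show ?thesis by simp
  qed
  have "(F (x + t *\<^sub>R axis i 1) - F x) \<bullet> axis i 1 \<le> diagL F * t"
  proof (rule lipschitz_directional_increment_le[OF L _ t])
    fix y assume "F differentiable (at y)"
    then show "frechet_derivative F (at y) (axis i 1) \<bullet> axis i 1 \<le> diagL F"
      unfolding diagL_def inner_axis using le
      by (intro cSup_upper) (auto intro!: bdd_aboveI[of _ K])
  qed
  then show ?thesis by (simp add: inner_axis)
qed

context monotone_map begin

lemma diagL_increment: "t \<ge> 0 \<Longrightarrow> F (x + t *\<^sub>R axis i 1) $ i - F x $ i \<le> diagL F * t"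
  using lipschitz_wrt_imp_lipschitz_on[OF lip] diagonal_increment_le_diagL by blast

lemma cayley_converges_small_step:
  assumes "c > 0"
  shows "\<exists>xs. F xs = 0 \<and> (\<forall>z. F z = 0 \<longrightarrow> z = xs) \<and>
        (\<exists>\<alpha>0 > 0. \<forall>\<alpha>. 0 < \<alpha> \<and> \<alpha> \<le> \<alpha>0 \<longrightarrow> (\<forall>x0.
           (\<lambda>k. N ((cayley \<alpha> F ^^ k) x0 - xs)) \<longlonglongrightarrow> 0 \<and>
           (\<forall>k. N ((cayley \<alpha> F ^^ Suc k) x0 - xs)
                \<le> (exp (-\<alpha> * c) + exp (\<alpha> * l) - 1 - \<alpha> * l) / (1 + \<alpha> * c)
                  * N ((cayley \<alpha> F ^^ k) x0 - xs))))"
proof -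
  obtain xs where xs: "F xs = 0" "\<And>z. F z = 0 \<Longrightarrow> z = xs" using unique_zero[OF assms] by blast
  obtain \<alpha>0 where \<alpha>0: "\<alpha>0 > 0"
    "\<And>\<alpha>. 0 < \<alpha> \<Longrightarrow> \<alpha> \<le> \<alpha>0 \<Longrightarrow> exp (- \<alpha> * c) + exp (\<alpha> * l) - 1 - \<alpha> * l < 1 + \<alpha> * c"
    using exp_factor_small[OF assms, of l] by blast
  have "(\<lambda>k. N ((cayley \<alpha> F ^^ k) x0 - xs)) \<longlonglongrightarrow> 0 \<and>
      (\<forall>k. N ((cayley \<alpha> F ^^ Suc k) x0 - xs)
         \<le> (exp (-\<alpha> * c) + exp (\<alpha> * l) - 1 - \<alpha> * l) / (1 + \<alpha> * c) * N ((cayley \<alpha> F ^^ k) x0 - xs))"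
    if \<alpha>: "0 < \<alpha>" "\<alpha> \<le> \<alpha>0" for \<alpha> x0
  proof -
    define E where "E = exp (- \<alpha> * c) + exp (\<alpha> * l) - 1 - \<alpha> * l"
    have "exp (\<alpha> * l) \<ge> 1 + \<alpha> * l" by (rule exp_ge_add_one_self)
    then have E0: "E \<ge> 0" using exp_ge_zero[of "- \<alpha> * c"] unfolding E_def by linarith
    have pos: "1 + \<alpha> * c > 0" using \<alpha> assms by (simp add: add_pos_pos)
    have "E / (1 + \<alpha> * c) < 1" using \<alpha>0(2)[OF \<alpha>] pos by (simp add: E_def)
    moreover have "N (cayley \<alpha> F x - xs) \<le> E / (1 + \<alpha> * c) * N (x - xs)" for x
      using forward_step[OF \<alpha>(1) xs(1)] by (intro cayley_step[OF \<alpha>(1) xs(1)] E0) (simp add: E_def)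
    ultimately show ?thesis
      using cayley_iteration[OF \<alpha>(1) xs(1)] unfolding E_def by blast
  qed
  then show ?thesis using xs \<alpha>0(1) by blast
qed

lemma cayley_converges_diag_weighted:
  assumes "c > 0" and N: "diag_weighted_l1_or_linf N"
  shows "\<exists>xs. F xs = 0 \<and> (\<forall>z. F z = 0 \<longrightarrow> z = xs) \<and>
        (\<forall>\<alpha>. 0 < \<alpha> \<and> \<alpha> \<le> 1 / diagL F \<longrightarrow> (\<forall>x0.
           (\<lambda>k. N ((cayley \<alpha> F ^^ k) x0 - xs)) \<longlonglongrightarrow> 0 \<and>
           (\<forall>k. N ((cayley \<alpha> F ^^ Suc k) x0 - xs)
                \<le> (1 - \<alpha> * c) / (1 + \<alpha> * c) * N ((cayley \<alpha> F ^^ k) x0 - xs))))"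
proof -
  obtain xs where xs: "F xs = 0" "\<And>z. F z = 0 \<Longrightarrow> z = xs" using unique_zero[OF assms(1)] by blast
  have "(\<lambda>k. N ((cayley \<alpha> F ^^ k) x0 - xs)) \<longlonglongrightarrow> 0 \<and>
      (\<forall>k. N ((cayley \<alpha> F ^^ Suc k) x0 - xs)
         \<le> (1 - \<alpha> * c) / (1 + \<alpha> * c) * N ((cayley \<alpha> F ^^ k) x0 - xs))"
    if \<alpha>: "0 < \<alpha>" "\<alpha> \<le> 1 / diagL F" for \<alpha> x0
  proof -
    \<comment> \<open>A nonempty range of step sizes forces \<open>diagL F > 0\<close>: it is empty
      for negative values, and for 0 because \<open>1 / 0 = 0\<close>.\<close>
    have "1 / diagL F > 0" using \<alpha> by linarith
    then have dpos: "diagL F > 0" by simp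
    then have \<alpha>d: "\<alpha> * diagL F \<le> 1" using \<alpha>(2) by (simp add: pos_le_divide_eq)
    have fwd: "N (x - \<alpha> *\<^sub>R F x - xs) \<le> (1 - \<alpha> * c) * N (x - xs)" for x
      using forward_step_diag_weighted[OF N diagL_increment \<alpha>(1) \<alpha>d, of x xs] xs(1) by simp
    \<comment> \<open>Read off the forward estimate at a point other than \<open>xs\<close>, since
      its left side is nonnegative.\<close>
    have "1 - \<alpha> * c \<ge> 0"
    proof -
      obtain y :: "real^'n" where y: "y \<noteq> xs" using UNIV_not_singleton by (metis UNIV_eq_I singletonI)
      have "0 \<le> (1 - \<alpha> * c) * N (y - xs)" using fwd[of y] N_nonneg order_trans by blast
      moreover have "N (y - xs) > 0" using y by (simp add: less_le)
      ultimately show ?thesis by (simp add: zero_le_mult_iff)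
    qed
    then have "N (cayley \<alpha> F x - xs) \<le> (1 - \<alpha> * c) / (1 + \<alpha> * c) * N (x - xs)" for x
      by (intro cayley_step[OF \<alpha>(1) xs(1) fwd])
    moreover have "(1 - \<alpha> * c) / (1 + \<alpha> * c) < 1" using mult_pos_pos[OF \<alpha>(1) assms(1)] by simp
    ultimately show ?thesis using cayley_iteration[OF \<alpha>(1) xs(1)] by blast
  qed
  then show ?thesis using xs by blast
qed

text \<open>With G = Id - F / d nonexpansive, the resolvent R satisfies R = (1 - t) Id + t (G o R), so it is an
  averaged map for every step size.\<close>

lemma resolvent_iteration_converges:
  assumes N: "diag_weighted_l1_or_linf N" and p: "F p = 0" and \<alpha>: "\<alpha> > 0"
  shows "\<exists>xs. F xs = 0 \<and> (\<lambda>k. N ((resolvent \<alpha> F ^^ k) x0 - xs)) \<longlonglongrightarrow> 0"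
proof -
  \<comment> \<open>Any positive upper bound of \<open>diagL F\<close> serves; this one also covers
    \<open>diagL F \<le> 0\<close>.\<close>
  define d where "d = \<bar>diagL F\<bar> + 1"
  have d: "d > 0" by (simp add: d_def)
  have inc: "F (x + t *\<^sub>R axis i 1) $ i - F x $ i \<le> d * t" if "t \<ge> 0" for x i t
  proof -
    have "diagL F * t \<le> d * t" using that by (intro mult_right_mono) (auto simp: d_def)
    then show ?thesis using diagL_increment[OF that, of x i] by linarith
  qed
  define G where "G = (\<lambda>x. x - (1 / d) *\<^sub>R F x)"
  have G: "N (G x - G y) \<le> N (x - y)" for x y
  proof -
    have "N (G x - G y) \<le> (1 - 1 / d * c) * N (x - y)"
      unfolding G_def by (rule forward_step_diag_weighted[OF N inc]) (use d in auto)
    also have "\<dots> \<le> 1 * N (x - y)"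
      using c_nonneg d by (intro mult_right_mono) auto
    finally show ?thesis by simp
  qed
  \<comment> \<open>The solution of \<open>(1 - t) * \<alpha> = t / d\<close>, for which the terms
    in \<open>F (J x)\<close> cancel.\<close>
  define t where "t = \<alpha> * d / (1 + \<alpha> * d)"
  have \<alpha>d: "\<alpha> * d > 0" using \<alpha> d by simp
  have t: "0 < t" "t < 1" using \<alpha>d by (auto simp: t_def)
  have "t * (1 + \<alpha> * d) = \<alpha> * d" using \<alpha>d by (simp add: t_def)
  then have t_eq: "(1 - t) * \<alpha> = t * (1 / d)" using d by (simp add: field_simps)
  define J where "J = resolvent \<alpha> F"
  have J: "J x + \<alpha> *\<^sub>R F (J x) = x" for x unfolding J_def by (rule resolvent[OF \<alpha>])
  have avg: "J x = (1 - t) *\<^sub>R x + t *\<^sub>R G (J x)" for x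
  proof -
    have "(1 - t) *\<^sub>R x + t *\<^sub>R G (J x) = (1 - t) *\<^sub>R (J x + \<alpha> *\<^sub>R F (J x)) + t *\<^sub>R G (J x)"
      by (simp only: J)
    also have "\<dots> = J x + ((1 - t) * \<alpha> - t * (1 / d)) *\<^sub>R F (J x)"
      by (simp add: G_def algebra_simps)
    finally show ?thesis by (simp add: t_eq)
  qed
  have GJ: "N (G (J x) - G (J y)) \<le> N (x - y)" for x y
  proof -
    have "N (J x - J y) \<le> N (x - y) / (1 + \<alpha> * c)" unfolding J_def by (rule resolvent_contraction[OF \<alpha>])
    also have "\<dots> \<le> N (x - y) / 1" using \<alpha> c_nonneg by (intro divide_left_mono) (auto simp: add_pos_nonneg)
    finally show ?thesis using G[of "J x" "J y"] by simp
  qed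
  have "J p = p" unfolding J_def using p by (intro resolvent_eqI[OF \<alpha>]) simp
  from averaged_iteration_converges[OF GJ t avg this]
  obtain q where q: "J q = q" "(\<lambda>k. N ((J ^^ k) x0 - q)) \<longlonglongrightarrow> 0" by blast
  have "F q = 0" using J[of q] q(1) \<alpha> by simp
  then show ?thesis using q(2) unfolding J_def by blast
qed

end

text \<open>With \<open>b = c / diagL F\<close> this gives optimality of the largest admissible
  step.\<close>

lemma cayley_factor_decreasing:
  fixes a b :: real
  assumes "0 \<le> a" "a \<le> b"
  shows "(1 - b) / (1 + b) \<le> (1 - a) / (1 + a)"
  using assms by (simp add: divide_simps) (simp add: algebra_simps)

theorem theorem31:
  fixes N :: "real^'n \<Rightarrow> real" and F :: "real^'n \<Rightarrow> real^'n" and l :: real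
  assumes N: "is_norm N"
    and lip: "lipschitz_wrt N l F"
  shows
   "(\<forall>c > 0. norm_monotone N c F \<longrightarrow>
      (\<exists>xs. F xs = 0 \<and> (\<forall>z. F z = 0 \<longrightarrow> z = xs) \<and>
        (\<exists>\<alpha>0 > 0. \<forall>\<alpha>. 0 < \<alpha> \<and> \<alpha> \<le> \<alpha>0 \<longrightarrow> (\<forall>x0.
           (\<lambda>k. N ((cayley \<alpha> F ^^ k) x0 - xs)) \<longlonglongrightarrow> 0 \<and>
           (\<forall>k. N ((cayley \<alpha> F ^^ Suc k) x0 - xs)
                \<le> (exp (-\<alpha> * c) + exp (\<alpha> * l) - 1 - \<alpha> * l) / (1 + \<alpha> * c)
                  * N ((cayley \<alpha> F ^^ k) x0 - xs))))))
  \<and> (\<forall>c > 0. diag_weighted_l1_or_linf N \<and> norm_monotone N c F \<longrightarrow>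
      (\<exists>xs. F xs = 0 \<and> (\<forall>z. F z = 0 \<longrightarrow> z = xs) \<and>
        (\<forall>\<alpha>. 0 < \<alpha> \<and> \<alpha> \<le> 1 / diagL F \<longrightarrow> (\<forall>x0.
           (\<lambda>k. N ((cayley \<alpha> F ^^ k) x0 - xs)) \<longlonglongrightarrow> 0 \<and>
           (\<forall>k. N ((cayley \<alpha> F ^^ Suc k) x0 - xs)
                \<le> (1 - \<alpha> * c) / (1 + \<alpha> * c) * N ((cayley \<alpha> F ^^ k) x0 - xs))))) \<and>
      (\<forall>\<alpha>. 0 < \<alpha> \<and> \<alpha> \<le> 1 / diagL F \<longrightarrow>
         (1 - c / diagL F) / (1 + c / diagL F) \<le> (1 - \<alpha> * c) / (1 + \<alpha> * c)))
  \<and> (diag_weighted_l1_or_linf N \<and> norm_monotone N 0 F \<and> {x. F x = 0} \<noteq> {} \<longrightarrow>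
      (\<forall>\<alpha> > 0.
         (\<forall>x. (1/2) *\<^sub>R x + (1/2) *\<^sub>R cayley \<alpha> F x = resolvent \<alpha> F x) \<and>
         (\<forall>x0. \<exists>xs. F xs = 0 \<and> (\<lambda>k. N ((resolvent \<alpha> F ^^ k) x0 - xs)) \<longlonglongrightarrow> 0)))"
proof (intro conjI allI impI; (elim conjE)?)
  interpret norm_function N by unfold_locales (rule N)
  fix c :: real
  assume c: "c > 0" and m: "norm_monotone N c F"
  then interpret monotone_map N F l c by unfold_locales (rule lip)
  show "\<exists>xs. F xs = 0 \<and> (\<forall>z. F z = 0 \<longrightarrow> z = xs) \<and>
        (\<exists>\<alpha>0 > 0. \<forall>\<alpha>. 0 < \<alpha> \<and> \<alpha> \<le> \<alpha>0 \<longrightarrow> (\<forall>x0.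
           (\<lambda>k. N ((cayley \<alpha> F ^^ k) x0 - xs)) \<longlonglongrightarrow> 0 \<and>
           (\<forall>k. N ((cayley \<alpha> F ^^ Suc k) x0 - xs)
                \<le> (exp (-\<alpha> * c) + exp (\<alpha> * l) - 1 - \<alpha> * l) / (1 + \<alpha> * c)
                  * N ((cayley \<alpha> F ^^ k) x0 - xs))))"
    by (rule cayley_converges_small_step[OF c])
next
  interpret norm_function N by unfold_locales (rule N)
  fix c :: real
  assume c: "c > 0" and D: "diag_weighted_l1_or_linf N" and m: "norm_monotone N c F"
  then interpret monotone_map N F l c by unfold_locales (rule lip)
  show "\<exists>xs. F xs = 0 \<and> (\<forall>z. F z = 0 \<longrightarrow> z = xs) \<and>
        (\<forall>\<alpha>. 0 < \<alpha> \<and> \<alpha> \<le> 1 / diagL F \<longrightarrow> (\<forall>x0.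
           (\<lambda>k. N ((cayley \<alpha> F ^^ k) x0 - xs)) \<longlonglongrightarrow> 0 \<and>
           (\<forall>k. N ((cayley \<alpha> F ^^ Suc k) x0 - xs)
                \<le> (1 - \<alpha> * c) / (1 + \<alpha> * c) * N ((cayley \<alpha> F ^^ k) x0 - xs))))"
    by (rule cayley_converges_diag_weighted[OF c D])
next
  fix c \<alpha> :: real
  assume "c > 0" "0 < \<alpha>" "\<alpha> \<le> 1 / diagL F"
  then show "(1 - c / diagL F) / (1 + c / diagL F) \<le> (1 - \<alpha> * c) / (1 + \<alpha> * c)"
    using mult_right_mono[of \<alpha> "1 / diagL F" c] by (intro cayley_factor_decreasing) auto
next
  fix \<alpha> :: real and x
  show "(1/2) *\<^sub>R x + (1/2) *\<^sub>R cayley \<alpha> F x = resolvent \<alpha> F x"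
    by (simp add: cayley_def algebra_simps)
next
  interpret norm_function N by unfold_locales (rule N)
  fix \<alpha> :: real and x0
  assume \<alpha>: "\<alpha> > 0" and D: "diag_weighted_l1_or_linf N" and m: "norm_monotone N 0 F"
    and z: "{x. F x = 0} \<noteq> {}"
  interpret monotone_map N F l 0 by unfold_locales (rule lip m)+
  obtain p where "F p = 0" using z by auto
  then show "\<exists>xs. F xs = 0 \<and> (\<lambda>k. N ((resolvent \<alpha> F ^^ k) x0 - xs)) \<longlonglongrightarrow> 0"
    using resolvent_iteration_converges[OF D _ \<alpha>] by blast
qed

end
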